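(* Let $(R_0,\mathfrak m)$ be an Artinian local equicharacteristic ring and $H:\mathbb N\to\mathbb N$ a function. Then the following conditions are equivalent: (i) There exists a standard $R_0$-algebra $S$ such that $H=H_S$. (ii) $H(0)=\lambda_{R_0}(R_0)$ and $H(n+1)\le (H(n)_n)^+_+$ for all $n\ge 1$.
   Context: $\mathbb N$ includes $0$. A local ring is equicharacteristic if it has the same characteristic as its residue field. $\lambda_{R_0}$ denotes length of $R_0$-modules. A standard $R_0$-algebra is a graded algebra $S=R_0[X_1,\dots,X_b]/I$ for some $b\ge1$, where $\deg X_i=1$ and $I$ is a homogeneous ideal contained in $R_+=\bigoplus_{n\ge1}R_n$, $R=R_0[X_1,\dots,X_b]$. Its Hilbert function is $H_S(n)=\lambda_{R_0}(S_n)$. Binomial operator: for integers $n,d\ge 1$ there are unique integers $k_d>k_{d-1}>\dots>k_\delta\ge\delta\ge1$ with $n=\binom{k_d}{d}+\binom{k_{d-1}}{d-1}+\dots+\binom{k_\delta}{\delta}$. Define $(n_d)^+_+=\binom{k_d+1}{d+1}+\binom{k_{d-1}+1}{d}+\dots+\binom{k_\delta+1}{\delta+1}$, and $(0_d)^+_+=0$ for all $d\ge1$. *)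

theory Defs
  imports "HOL-Library.Multiset" "HOL-Library.Extended_Nat" "HOL-Algebra.Algebra"
begin

section \<open>Artinian local equicharacteristic rings\<close>

locale artinian_ring = cring +
  assumes descending_chain_condition:
    "\<lbrakk>\<And>i::nat. ideal (C i) R; \<And>i. C (Suc i) \<subseteq> C i\<rbrakk> \<Longrightarrow> \<exists>n. \<forall>i\<ge>n. C i = C n"

locale local_ring = cring R + maximalideal \<mm> R for \<mm> and R (structure) +
  assumes maximalideal_unique: "maximalideal J R \<Longrightarrow> J = \<mm>"

text \<open>The gcd is the nonnegative generator of the kernel of the map from the integers to the ring;
  this is how the type class version \<^const>\<open>semiring_char\<close> is defined.\<close>

definition ring_char :: "('a, 'm) ring_scheme \<Rightarrow> nat" where
  "ring_char R = Gcd {n :: nat. [n] \<cdot>\<^bsub>R\<^esub> \<one>\<^bsub>R\<^esub> = \<zero>\<^bsub>R\<^esub>}"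

definition equicharacteristic :: "'a set \<Rightarrow> ('a, 'm) ring_scheme \<Rightarrow> bool" where
  "equicharacteristic \<mm> R \<longleftrightarrow> ring_char R = ring_char (R Quot \<mm>)"


section \<open>Length of modules\<close>

text \<open>The supremum of the lengths of strictly increasing finite chains of submodules; it is
  \<^term>\<open>\<infinity>\<close> exactly when there is no composition series.\<close>

definition module_length :: "('a, 'm) ring_scheme \<Rightarrow> ('a, 'b, 'n) module_scheme \<Rightarrow> enat" where
  "module_length R M =
     Sup {enat k | k. \<exists>N. (\<forall>i\<le>k. submodule (N i) R M) \<and> (\<forall>i<k. N i \<subset> N (Suc i))}"

definition self_module :: "('a, 'm) ring_scheme \<Rightarrow> ('a, 'a) module" where
  "self_module R = \<lparr>carrier = carrier R, monoid.mult = monoid.mult R, one = one R,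
     ring.zero = ring.zero R, add = add R, smult = monoid.mult R\<rparr>"


section \<open>Polynomial rings in finitely many variables\<close>

text \<open>A polynomial in \<open>X\<^sub>0, \<dots>, X\<^sub>b\<^sub>-\<^sub>1\<close> is its family of coefficients, indexed by the monomials;
  a monomial is the multiset of the indices of its variables, so that its degree is its size and
  the product of monomials is the sum of multisets.\<close>

definition mpoly_ring :: "('a, 'm) ring_scheme \<Rightarrow> nat \<Rightarrow> (nat multiset \<Rightarrow> 'a) ring" where
  "mpoly_ring R b =
    \<lparr>carrier = {p. range p \<subseteq> carrier R \<and> finite {u. p u \<noteq> \<zero>\<^bsub>R\<^esub>} \<and>
                   (\<forall>u. p u \<noteq> \<zero>\<^bsub>R\<^esub> \<longrightarrow> set_mset u \<subseteq> {..<b})},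
     monoid.mult = (\<lambda>p q u. \<Oplus>\<^bsub>R\<^esub>v\<in>{v. v \<subseteq># u}. p v \<otimes>\<^bsub>R\<^esub> q (u - v)),
     one = (\<lambda>u. if u = {#} then \<one>\<^bsub>R\<^esub> else \<zero>\<^bsub>R\<^esub>),
     ring.zero = (\<lambda>u. \<zero>\<^bsub>R\<^esub>),
     add = (\<lambda>p q u. p u \<oplus>\<^bsub>R\<^esub> q u)\<rparr>"

definition mpoly_const :: "('a, 'm) ring_scheme \<Rightarrow> 'a \<Rightarrow> nat multiset \<Rightarrow> 'a" where
  "mpoly_const R a = (\<lambda>u. if u = {#} then a else \<zero>\<^bsub>R\<^esub>)"

definition mpoly_grade :: "('a, 'm) ring_scheme \<Rightarrow> nat \<Rightarrow> nat \<Rightarrow> (nat multiset \<Rightarrow> 'a) set" where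
  "mpoly_grade R b n = {p \<in> carrier (mpoly_ring R b). \<forall>u. p u \<noteq> \<zero>\<^bsub>R\<^esub> \<longrightarrow> size u = n}"

definition mpoly_positive_part :: "('a, 'm) ring_scheme \<Rightarrow> nat \<Rightarrow> (nat multiset \<Rightarrow> 'a) set" where
  "mpoly_positive_part R b = {p \<in> carrier (mpoly_ring R b). \<forall>u. p u \<noteq> \<zero>\<^bsub>R\<^esub> \<longrightarrow> size u \<ge> 1}"

definition homogeneous_component ::
  "('a, 'm) ring_scheme \<Rightarrow> nat \<Rightarrow> (nat multiset \<Rightarrow> 'a) \<Rightarrow> nat multiset \<Rightarrow> 'a" where
  "homogeneous_component R n p = (\<lambda>u. if size u = n then p u else \<zero>\<^bsub>R\<^esub>)"

definition homogeneous_ideal ::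
  "('a, 'm) ring_scheme \<Rightarrow> nat \<Rightarrow> (nat multiset \<Rightarrow> 'a) set \<Rightarrow> bool" where
  "homogeneous_ideal R b I \<longleftrightarrow>
     ideal I (mpoly_ring R b) \<and> (\<forall>p\<in>I. \<forall>n. homogeneous_component R n p \<in> I)"


section \<open>Standard graded algebras and their Hilbert functions\<close>

record ('a, 'b) graded_algebra = "('a, 'b) module" +
  grade :: "nat \<Rightarrow> 'b set"

definition graded_quotient ::
  "('a, 'm) ring_scheme \<Rightarrow> nat \<Rightarrow> (nat multiset \<Rightarrow> 'a) set \<Rightarrow>
   ('a, (nat multiset \<Rightarrow> 'a) set) graded_algebra" where
  "graded_quotient R b I = (let P = mpoly_ring R b; Q = P Quot I in
     \<lparr>carrier = carrier Q, monoid.mult = monoid.mult Q, one = one Q,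
      ring.zero = ring.zero Q, add = add Q,
      smult = (\<lambda>a x. (I +>\<^bsub>P\<^esub> mpoly_const R a) \<otimes>\<^bsub>Q\<^esub> x),
      grade = (\<lambda>n. (\<lambda>p. I +>\<^bsub>P\<^esub> p) ` mpoly_grade R b n)\<rparr>)"

definition standard_algebra ::
  "('a, 'm) ring_scheme \<Rightarrow> ('a, (nat multiset \<Rightarrow> 'a) set) graded_algebra \<Rightarrow> bool" where
  "standard_algebra R S \<longleftrightarrow>
     (\<exists>b\<ge>1. \<exists>I. homogeneous_ideal R b I \<and> I \<subseteq> mpoly_positive_part R b \<and> S = graded_quotient R b I)"

definition hilbert_function ::
  "('a, 'm) ring_scheme \<Rightarrow> ('a, 'b) graded_algebra \<Rightarrow> nat \<Rightarrow> enat" where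
  "hilbert_function R S n = module_length R (S\<lparr>carrier := grade S n\<rparr>)"


section \<open>The binomial operator\<close>

definition binomial_expansion :: "nat \<Rightarrow> nat \<Rightarrow> nat \<Rightarrow> (nat \<Rightarrow> nat) \<Rightarrow> bool" where
  "binomial_expansion n d \<delta> k \<longleftrightarrow>
     1 \<le> \<delta> \<and> \<delta> \<le> d \<and> strict_mono_on {\<delta>..d} k \<and> \<delta> \<le> k \<delta> \<and> n = (\<Sum>i=\<delta>..d. k i choose i)"

text \<open>For \<open>n, d \<ge> 1\<close> the expansion is unique, up to the irrelevant values of \<open>k\<close> outside
  \<open>{\<delta>..d}\<close>; the description operator is applied to the resulting number, which is unique.\<close>

definition binomial_shift :: "nat \<Rightarrow> nat \<Rightarrow> nat" where
  "binomial_shift n d = (if n = 0 then 0 else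
     (THE m. \<exists>\<delta> k. binomial_expansion n d \<delta> k \<and> m = (\<Sum>i=\<delta>..d. (k i + 1) choose (i + 1))))"

section \<open>The polynomial ring is a ring and its graded quotients are algebras\<close>

lemma finite_submultisets: "finite {v. v \<subseteq># (u :: 'x multiset)}"
proof (induction u)
  case empty then show ?case by simp
next
  case (add x u)
  have "{v. v \<subseteq># add_mset x u} \<subseteq> {v. v \<subseteq># u} \<union> add_mset x ` {v. v \<subseteq># u}"
  proof
    fix v assume v: "v \<in> {v. v \<subseteq># add_mset x u}"
    show "v \<in> {v. v \<subseteq># u} \<union> add_mset x ` {v. v \<subseteq># u}"
    proof (cases "x \<in># v")
      case True
      then obtain w where "v = add_mset x w" by (metis insert_DiffM)
      then show ?thesis using v by auto
    next
      case False
      then have "v \<subseteq># u" using v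
        unfolding subseteq_mset_def mem_Collect_eq count_add_mset not_in_iff by (metis le0)
      then show ?thesis by auto
    qed
  qed
  then show ?case using add by (meson finite_UnI finite_imageI finite_subset)
qed

lemma diff_diff_submultiset: "v \<subseteq># u \<Longrightarrow> u - (u - v) = (v :: 'x multiset)"
  by (simp add: multiset_eq_iff subseteq_mset_def)

context cring begin

lemma convol_swap:
  assumes "\<And>u. p u \<in> carrier R" "\<And>u. q u \<in> carrier R" "\<And>u. r u \<in> carrier R"
  shows "(\<Oplus>u\<in>{u. u \<subseteq># w}. (\<Oplus>v\<in>{v. v \<subseteq># u}. p v \<otimes> q (u - v)) \<otimes> r (w - u))
       = (\<Oplus>v\<in>{v. v \<subseteq># w}. p v \<otimes> (\<Oplus>u\<in>{u. u \<subseteq># w - v}. q u \<otimes> r (w - v - u)))"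
proof -
  let ?g = "\<lambda>(u,v). p v \<otimes> q (u - v) \<otimes> r (w - u)"
  let ?T = "\<Union>u\<in>{u. u \<subseteq># w}. Pair u ` {v. v \<subseteq># u}"
  let ?h = "\<lambda>v u. (u + v, v)"
  have T2: "?T = (\<Union>v\<in>{v. v \<subseteq># w}. (\<lambda>u. (u + v, v)) ` {u. u \<subseteq># w - v})"
  proof (intro subset_antisym subsetI)
    fix x assume "x \<in> ?T"
    then obtain u v where x: "x = (u, v)" and uv: "u \<subseteq># w" "v \<subseteq># u" by blast
    then have "v \<subseteq># w" "u - v \<subseteq># w - v" "u = u - v + v"
      by (auto simp: subseteq_mset_def multiset_eq_iff intro: le_trans diff_le_mono)
    then show "x \<in> (\<Union>v\<in>{v. v \<subseteq># w}. ?h v ` {u. u \<subseteq># w - v})"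
      using x by blast
  next
    fix x assume "x \<in> (\<Union>v\<in>{v. v \<subseteq># w}. ?h v ` {u. u \<subseteq># w - v})"
    then obtain u v where x: "x = (u + v, v)" and uv: "v \<subseteq># w" "u \<subseteq># w - v" by blast
    have "u + v \<subseteq># w"
      using uv by (simp add: subset_mset.le_diff_conv2)
    then show "x \<in> ?T" using x by auto
  qed
  have "(\<Oplus>u\<in>{u. u \<subseteq># w}. (\<Oplus>v\<in>{v. v \<subseteq># u}. p v \<otimes> q (u - v)) \<otimes> r (w - u))
     = (\<Oplus>u\<in>{u. u \<subseteq># w}. \<Oplus>v\<in>{v. v \<subseteq># u}. ?g (u,v))"
    using assms by (intro finsum_cong' refl) (auto intro!: finsum_ldistr finsum_closed simp: finite_submultisets Pi_def)
  also have "\<dots> = (\<Oplus>u\<in>{u. u \<subseteq># w}. \<Oplus>x\<in>Pair u ` {v. v \<subseteq># u}. ?g x)"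
    using assms by (intro finsum_cong' refl) (auto simp: finsum_reindex inj_on_def Pi_def intro!: finsum_closed)
  also have "\<dots> = (\<Oplus>x\<in>?T. ?g x)"
    using assms by (intro add.finprod_UN_disjoint[symmetric]) (auto simp: finite_submultisets pairwise_def disjnt_def)
  also have "\<dots> = (\<Oplus>v\<in>{v. v \<subseteq># w}. \<Oplus>x\<in>?h v ` {u. u \<subseteq># w - v}. ?g x)"
    unfolding T2 using assms by (intro add.finprod_UN_disjoint) (auto simp: finite_submultisets pairwise_def disjnt_def)
  also have "\<dots> = (\<Oplus>v\<in>{v. v \<subseteq># w}. \<Oplus>u\<in>{u. u \<subseteq># w - v}. ?g (?h v u))"
    using assms by (intro finsum_cong' refl) (auto simp: finsum_reindex inj_on_def Pi_def intro!: finsum_closed)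
  also have "\<dots> = (\<Oplus>v\<in>{v. v \<subseteq># w}. p v \<otimes> (\<Oplus>u\<in>{u. u \<subseteq># w - v}. q u \<otimes> r (w - v - u)))"
    using assms apply (intro finsum_cong' refl) 
     apply (auto intro!: finsum_closed simp: Pi_def finsum_rdistr finite_submultisets m_assoc )
    by (auto intro!: finsum_cong' simp: algebra_simps)
  finally show ?thesis .
qed

lemma convol_comm:
  assumes "\<And>u. p u \<in> carrier R" "\<And>u. q u \<in> carrier R"
  shows "(\<Oplus>v\<in>{v. v \<subseteq># u}. p v \<otimes> q (u - v)) = (\<Oplus>v\<in>{v. v \<subseteq># u}. q v \<otimes> p (u - v))"
proof -
  have img: "{v. v \<subseteq># u} = (\<lambda>v. u - v) ` {v. v \<subseteq># u}"
    by (auto simp: image_iff) (metis diff_diff_submultiset diff_subset_eq_self)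
  have "(\<Oplus>v\<in>(\<lambda>v. u - v) ` {v. v \<subseteq># u}. p v \<otimes> q (u - v))
      = (\<Oplus>v\<in>{v. v \<subseteq># u}. p (u - v) \<otimes> q (u - (u - v)))"
    using assms by (intro finsum_reindex) (auto simp: inj_on_def Pi_def, metis diff_diff_submultiset)
  also have "\<dots> = (\<Oplus>v\<in>{v. v \<subseteq># u}. q v \<otimes> p (u - v))"
    using assms by (intro finsum_cong') (auto simp: m_comm diff_diff_submultiset)
  finally show ?thesis using img by metis
qed

lemma mpoly_ring_cring: "cring (mpoly_ring R b)"
proof (rule cringI)
  have sums: "finsum R f A \<noteq> \<zero> \<Longrightarrow> \<exists>v\<in>A. f v \<noteq> \<zero>" for f :: "nat multiset \<Rightarrow> 'a" and A
    by (metis add.finprod_one_eqI)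
  show "abelian_group (mpoly_ring R b)"
  proof (rule abelian_groupI)
    fix x y assume "x \<in> carrier (mpoly_ring R b)" "y \<in> carrier (mpoly_ring R b)"
    then show "x \<oplus>\<^bsub>mpoly_ring R b\<^esub> y \<in> carrier (mpoly_ring R b)"
      apply (auto simp: mpoly_ring_def range_subsetD)
       apply (rule finite_subset[of _ "{u. x u \<noteq> \<zero>} \<union> {u. y u \<noteq> \<zero>}"])
        apply auto
      by (metis r_zero zero_closed lessThan_iff subsetD)
  next
    fix x assume x: "x \<in> carrier (mpoly_ring R b)"
    show "\<exists>y\<in>carrier (mpoly_ring R b). y \<oplus>\<^bsub>mpoly_ring R b\<^esub> x = \<zero>\<^bsub>mpoly_ring R b\<^esub>"
      apply (rule bexI[of _ "\<lambda>u. \<ominus> x u"])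
      using x apply (auto simp: mpoly_ring_def range_subsetD l_neg)
      done
  qed (auto simp: mpoly_ring_def range_subsetD a_ac)
  show "Group.comm_monoid (mpoly_ring R b)"
  proof (rule comm_monoidI)
    fix x y assume xy: "x \<in> carrier (mpoly_ring R b)" "y \<in> carrier (mpoly_ring R b)"
    then have c: "\<And>u. x u \<in> carrier R" "\<And>u. y u \<in> carrier R" by (auto simp: mpoly_ring_def)
    let ?f = "\<lambda>u. \<Oplus>v\<in>{v. v \<subseteq># u}. x v \<otimes> y (u - v)"
    have *: "\<exists>v. v \<subseteq># u \<and> x v \<noteq> \<zero> \<and> y (u - v) \<noteq> \<zero>" if "?f u \<noteq> \<zero>" for u
      using sums[OF that] c by fastforce
    have "{u. ?f u \<noteq> \<zero>} \<subseteq> (\<lambda>(v,w). v + w) ` ({u. x u \<noteq> \<zero>} \<times> {u. y u \<noteq> \<zero>})"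
    proof
      fix u assume "u \<in> {u. ?f u \<noteq> \<zero>}"
      then obtain v where "v \<subseteq># u" "x v \<noteq> \<zero>" "y (u - v) \<noteq> \<zero>" using * by blast
      then show "u \<in> (\<lambda>(v,w). v + w) ` ({u. x u \<noteq> \<zero>} \<times> {u. y u \<noteq> \<zero>})"
        by (intro image_eqI[of _ _ "(v, u - v)"]) auto
    qed
    then have fin: "finite {u. ?f u \<noteq> \<zero>}"
      using xy by (elim finite_subset) (auto simp: mpoly_ring_def)
    have vars: "set_mset u \<subseteq> {..<b}" if nz: "?f u \<noteq> \<zero>" for u
    proof -
      obtain v where v: "v \<subseteq># u" "x v \<noteq> \<zero>" "y (u - v) \<noteq> \<zero>" using *[OF nz] by blast
      then have "set_mset v \<subseteq> {..<b}" "set_mset (u - v) \<subseteq> {..<b}" using xy unfolding mpoly_ring_def by auto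
      then have "set_mset (v + (u - v)) \<subseteq> {..<b}" by (metis set_mset_union Un_least)
      then show ?thesis using v by simp
    qed
    show "x \<otimes>\<^bsub>mpoly_ring R b\<^esub> y \<in> carrier (mpoly_ring R b)"
      using fin vars c by (auto simp: mpoly_ring_def intro!: finsum_closed)
    show "x \<otimes>\<^bsub>mpoly_ring R b\<^esub> y = y \<otimes>\<^bsub>mpoly_ring R b\<^esub> x"
      using convol_comm[of x y] c by (auto simp: mpoly_ring_def)
  next
    fix x y z assume "x \<in> carrier (mpoly_ring R b)" "y \<in> carrier (mpoly_ring R b)" "z \<in> carrier (mpoly_ring R b)"
    then have c: "\<And>u. x u \<in> carrier R" "\<And>u. y u \<in> carrier R" "\<And>u. z u \<in> carrier R" by (auto simp: mpoly_ring_def)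
    then show "x \<otimes>\<^bsub>mpoly_ring R b\<^esub> y \<otimes>\<^bsub>mpoly_ring R b\<^esub> z = x \<otimes>\<^bsub>mpoly_ring R b\<^esub> (y \<otimes>\<^bsub>mpoly_ring R b\<^esub> z)"
      using convol_swap[of x y z] by (auto simp: mpoly_ring_def)
  next
    fix x assume "x \<in> carrier (mpoly_ring R b)"
    then have c: "\<And>u. x u \<in> carrier R" by (auto simp: mpoly_ring_def)
    have "(\<Oplus>v\<in>{v. v \<subseteq># u}. (if v = {#} then \<one> else \<zero>) \<otimes> x (u - v)) = x u" for u
    proof -
      have "(\<Oplus>v\<in>{v. v \<subseteq># u}. (if v = {#} then \<one> else \<zero>) \<otimes> x (u - v))
          = (\<Oplus>v\<in>{v. v \<subseteq># u}. if {#} = v then x (u - v) else \<zero>)"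
        using c by (intro finsum_cong') auto
      also have "\<dots> = x u"
        using finsum_singleton[of "{#}" "{v. v \<subseteq># u}" "\<lambda>v. x (u - v)"] c by (simp add: finite_submultisets Pi_def)
      finally show ?thesis .
    qed
    then show "\<one>\<^bsub>mpoly_ring R b\<^esub> \<otimes>\<^bsub>mpoly_ring R b\<^esub> x = x"
      by (simp add: mpoly_ring_def)
  next
    show "\<one>\<^bsub>mpoly_ring R b\<^esub> \<in> carrier (mpoly_ring R b)"
      by (auto simp: mpoly_ring_def)
  qed
next
  fix x y z assume "x \<in> carrier (mpoly_ring R b)" "y \<in> carrier (mpoly_ring R b)" "z \<in> carrier (mpoly_ring R b)"
  then have c: "\<And>u. x u \<in> carrier R" "\<And>u. y u \<in> carrier R" "\<And>u. z u \<in> carrier R" by (auto simp: mpoly_ring_def)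
  show "(x \<oplus>\<^bsub>mpoly_ring R b\<^esub> y) \<otimes>\<^bsub>mpoly_ring R b\<^esub> z = x \<otimes>\<^bsub>mpoly_ring R b\<^esub> z \<oplus>\<^bsub>mpoly_ring R b\<^esub> y \<otimes>\<^bsub>mpoly_ring R b\<^esub> z"
    using c by (auto simp: mpoly_ring_def l_distr finsum_addf)
qed

lemma graded_quotient_algebra: assumes I: "homogeneous_ideal R b I" shows "algebra R (graded_quotient R b I)"
proof -
  let ?P = "mpoly_ring R b"
  interpret P: cring ?P by (rule mpoly_ring_cring)
  interpret I: ideal I ?P using I by (simp add: homogeneous_ideal_def)
  interpret Q: cring "?P Quot I" by (rule I.quotient_is_cring[OF P.cring_axioms])
  have rh: "(+>\<^bsub>?P\<^esub>) I \<in> ring_hom ?P (?P Quot I)" by (rule I.rcos_ring_hom)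
  have cc: "a \<in> carrier R \<Longrightarrow> mpoly_const R a \<in> carrier ?P" for a
    by (auto simp: mpoly_const_def mpoly_ring_def)
  have ca: "a \<in> carrier R \<Longrightarrow> c \<in> carrier R \<Longrightarrow> mpoly_const R (a \<oplus> c) = mpoly_const R a \<oplus>\<^bsub>?P\<^esub> mpoly_const R c" for a c
    by (auto simp: mpoly_const_def mpoly_ring_def)
  have cm: "mpoly_const R (a \<otimes> c) = mpoly_const R a \<otimes>\<^bsub>?P\<^esub> mpoly_const R c" if ac: "a \<in> carrier R" "c \<in> carrier R" for a c
  proof
    fix u
    have "(\<Oplus>v\<in>{v. v \<subseteq># u}. mpoly_const R a v \<otimes> mpoly_const R c (u - v))
          = (\<Oplus>v\<in>{v. v \<subseteq># u}. if {#} = v then a \<otimes> mpoly_const R c u else \<zero>)"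
        using ac by (intro finsum_cong') (auto simp: mpoly_const_def)
    also have "\<dots> = a \<otimes> mpoly_const R c u"
        using finsum_singleton[of "{#}" "{v. v \<subseteq># u}" "\<lambda>v. a \<otimes> mpoly_const R c u"] ac by (simp add: finite_submultisets Pi_def mpoly_const_def)
    finally show "mpoly_const R (a \<otimes> c) u = (mpoly_const R a \<otimes>\<^bsub>?P\<^esub> mpoly_const R c) u"
      using ac by (auto simp: mpoly_ring_def mpoly_const_def)
  qed
  have c1: "mpoly_const R \<one> = \<one>\<^bsub>?P\<^esub>" by (auto simp: mpoly_const_def mpoly_ring_def)
  have clo: "a \<in> carrier R \<Longrightarrow> I +>\<^bsub>?P\<^esub> mpoly_const R a \<in> carrier (?P Quot I)" for a
    using rh cc by (auto simp: ring_hom_def)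
  let ?S = "graded_quotient R b I"
  have sel: "carrier ?S = carrier (?P Quot I)" "monoid.mult ?S = monoid.mult (?P Quot I)" "one ?S = one (?P Quot I)"
    "ring.zero ?S = ring.zero (?P Quot I)" "add ?S = add (?P Quot I)" "smult ?S = (\<lambda>a x. (I +>\<^bsub>?P\<^esub> mpoly_const R a) \<otimes>\<^bsub>?P Quot I\<^esub> x)"
    by (auto simp: graded_quotient_def Let_def)
  have "cring ?S"
  proof (rule cringI)
    show "abelian_group ?S"
    proof (rule abelian_groupI, unfold sel)
      fix x assume "x \<in> carrier (?P Quot I)"
      then show "\<exists>y\<in>carrier (?P Quot I). y \<oplus>\<^bsub>?P Quot I\<^esub> x = \<zero>\<^bsub>?P Quot I\<^esub>"
        by (intro bexI[of _ "\<ominus>\<^bsub>?P Quot I\<^esub> x"] Q.l_neg Q.a_inv_closed)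
    qed (rule Q.a_closed Q.zero_closed Q.a_assoc Q.a_comm Q.l_zero; assumption)+
    show "Group.comm_monoid ?S"
      by (rule comm_monoidI, unfold sel)
        (rule Q.m_closed Q.one_closed Q.m_assoc Q.l_one Q.m_comm; assumption)+
  qed (unfold sel, rule Q.l_distr)
  show ?thesis
    apply (rule algebraI)
    apply (rule is_cring)
    apply (rule \<open>cring ?S\<close>)
    apply (simp_all add: sel clo ca cm c1 cc ring_hom_add[OF rh] ring_hom_mult[OF rh] ring_hom_one[OF rh] Q.l_distr Q.r_distr Q.m_assoc)
    done
qed
end

end

theory Submission
  imports Defs "HOL-Library.Multiset_Order" "HOL-Library.Product_Lexorder"
begin

text \<open>Identify a monomial with its multiset of variables. In the multiset order, which on multisets
  of a fixed size is colexicographic, the multiset \<open>u\<close> of size \<open>d\<close> with exactly \<open>N\<close> predecessors of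
  its size encodes the \<open>d\<close>-th binomial expansion of \<open>N\<close>, and \<open>(N\<^sub>d)\<^sup>+\<^sub>+\<close> is the number of predecessors
  of \<open>u + {0}\<close>. Macaulay's bound for the shadow of a set of multisets is then proved by compressing
  the set until it is stable under replacing any variable by \<open>x\<^sub>0\<close>.

  For a homogeneous ideal \<open>I\<close> let \<open>L\<^sub>u\<close> be the ideal of leading coefficients at the monomial \<open>u\<close>. If
  \<open>0 = J\<^sub>0 \<subset> \<dots> \<subset> J\<^sub>e = R\<^sub>0\<close> is a composition series, the length of \<open>S\<^sub>n\<close> is the number of pairs \<open>(u, i)\<close>
  with \<open>u\<close> of degree \<open>n\<close> and \<open>J\<^sub>i\<^sub>+\<^sub>1\<close> not contained in \<open>J\<^sub>i + L\<^sub>u\<close>. Since \<open>J\<^sub>e\<^sub>-\<^sub>1\<close> and all proper \<open>L\<^sub>u\<close> lie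
  in the maximal ideal, these pairs become an order ideal of monomials when the largest variable of \<open>u\<close>
  is marked by \<open>i\<close> and all others by \<open>e - 1\<close>; this reduces the growth bound to Macaulay's. Conversely,
  given the bound, the initial segments of cardinality \<open>H(n)\<close> form an order ideal \<open>B\<close>, and one takes the
  quotient in which, in positive degrees, the maximal ideal and the monomials outside \<open>B\<close> are killed.\<close>

section \<open>Initial segments of multisets and binomial expansions\<close>

text \<open>Multiplicities differ at finitely many elements only, and the Huet-Oppen form of the
  order, read at the largest of these, excludes that \<open>u\<close> has the larger multiplicity
  there.\<close>

lemma less_multiset_pivot:
  fixes u v :: "'x::linorder multiset"
  assumes "u < v"
  obtains e where "count u e < count v e" "\<And>y. e < y \<Longrightarrow> count u y = count v y"
proof -
  let ?D = "{y. count u y \<noteq> count v y}"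
  have "?D \<subseteq> set_mset u \<union> set_mset v" by (auto simp: not_in_iff)
  then have fin: "finite ?D" by (rule finite_subset) auto
  have "u \<noteq> v" using assms by simp
  then have ne: "?D \<noteq> {}" by (auto simp: multiset_eq_iff)
  define e where "e = Max ?D"
  have e: "count u e \<noteq> count v e" using Max_in[OF fin ne] by (simp add: e_def)
  have above: "count u y = count v y" if "e < y" for y
    using Max_ge[OF fin, of y] that by (fastforce simp: e_def)
  have "\<not> count v e < count u e"
  proof
    assume "count v e < count u e"
    then obtain x where "e < x" "count u x < count v x"
      using assms by (auto simp: less_multiset\<^sub>H\<^sub>O)
    then show False using above by force
  qed
  with e show ?thesis by (intro that[OF _ above]) auto
qed

lemma less_multisetI_pivot:
  fixes u v :: "'x::linorder multiset"
  assumes "count u e < count v e" "\<And>y. e < y \<Longrightarrow> count u y = count v y"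
  shows "u < v"
proof (rule ccontr)
  assume "\<not> u < v"
  moreover have "u \<noteq> v" using assms(1) by auto
  ultimately have "v < u" by auto
  then obtain f where f: "count v f < count u f" "\<And>y. f < y \<Longrightarrow> count v y = count u y"
    by (rule less_multiset_pivot) blast
  then show False using assms by (metis less_irrefl not_less_iff_gr_or_eq)
qed

text \<open>Nothing of \<open>x\<close> lies below \<open>e\<close>, so \<open>x\<close> is a proper
  submultiset of \<open>u\<close>. For equal sizes this rules out a pivot at or below a lower bound
  of \<open>x\<close>.\<close>

lemma subset_mset_of_pivot:
  fixes x u :: "'x::linorder multiset"
  assumes "count x e < count u e" "\<And>y. e < y \<Longrightarrow> count x y = count u y" "\<And>y. y \<in># x \<Longrightarrow> e \<le> y"
  shows "size x < size u"
proof -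
  have "x \<subset># u"
    unfolding subset_mset_def
  proof
    show "x \<subseteq># u"
      unfolding subseteq_mset_def
    proof
      fix y show "count x y \<le> count u y"
        using assms(1) assms(2)[of y] assms(3)[of y]
        by (metis count_eq_zero_iff le_refl less_imp_le linorder_less_linear not_le zero_le)
    qed
    show "x \<noteq> u" using assms(1) by auto
  qed
  then show ?thesis by (rule mset_subset_size)
qed

text \<open>Equal sizes force the pivot of \<open>x < u\<close> above \<open>m\<close>, where adding
  \<open>m\<close> and \<open>0\<close> changes no multiplicity. Hence removing a minimum from a
  multiset below \<open>add_mset 0 u\<close> of the same size leaves one below
  \<open>u\<close>.\<close>

lemma add_min_less_add_zero_iff:
  fixes x u :: "nat multiset"
  assumes "size x = size u" "\<And>y. y \<in># x \<Longrightarrow> m \<le> y"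
  shows "add_mset m x < add_mset 0 u \<longleftrightarrow> x < u"
proof
  assume "x < u"
  then obtain e where e: "count x e < count u e" "\<And>y. e < y \<Longrightarrow> count x y = count u y"
    by (rule less_multiset_pivot) blast
  have "m < e"
  proof (rule ccontr)
    assume "\<not> m < e"
    then have "size x < size u"
      using assms(2) by (intro subset_mset_of_pivot[OF e]) fastforce+
    then show False using assms(1) by simp
  qed
  then show "add_mset m x < add_mset 0 u"
    using e by (intro less_multisetI_pivot[of _ e]) auto
next
  assume "add_mset m x < add_mset 0 u"
  then show "x < u"
    by (meson add_mset_le_le_le leD not_le_imp_less zero_le)
qed

section \<open>Ranks of multisets within their degree\<close>

definition seg :: "nat multiset \<Rightarrow> nat multiset set" where
  "seg u = {v. size v = size u \<and> v < u}"

lemma seg_empty [simp]: "seg {#} = {}"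
  by (auto simp: seg_def)

lemma less_multiset_mem_bound:
  fixes u v :: "'x::linorder multiset"
  assumes "v < u" "x \<in># v" "\<And>y. y \<in># u \<Longrightarrow> y \<le> m"
  shows "x \<le> m"
proof (rule ccontr)
  assume "\<not> x \<le> m"
  then have "u < v" using assms by (intro ex_gt_imp_less_multiset) force
  then show False using assms(1) by simp
qed

lemma finite_seg [simp]: "finite (seg u)"
proof (cases "u = {#}")
  case False
  have "seg u \<subseteq> multisets_of_size {..Max_mset u} (size u)"
    using less_multiset_mem_bound[of _ u _ "Max_mset u"]
    by (auto simp: seg_def multisets_of_size_def)
  then show ?thesis by (rule finite_subset) auto
qed (simp add: seg_def)

lemma card_seg_less:
  assumes "size u = size v" "u < v"
  shows "card (seg u) < card (seg v)"
proof (rule psubset_card_mono)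
  show "seg u \<subset> seg v" using assms by (auto simp: seg_def)
qed simp

lemma card_seg_mono: "size u = size v \<Longrightarrow> u \<le> v \<Longrightarrow> card (seg u) \<le> card (seg v)"
  by (cases "u = v") (auto simp: le_less card_seg_less less_imp_le)

lemma card_seg_less_iff: "size u = size v \<Longrightarrow> card (seg u) < card (seg v) \<longleftrightarrow> u < v"
  by (metis card_seg_less card_seg_mono not_le)

lemma card_seg_eq_iff: "size u = size v \<Longrightarrow> card (seg u) = card (seg v) \<longleftrightarrow> u = v"
  by (metis card_seg_less less_irrefl linorder_less_linear)

text \<open>The rank map sends \<open>seg u\<close> injectively into the numbers below
  \<open>card (seg u)\<close>; both sets have the same finite cardinality, so every such rank is
  attained.\<close>

lemma ex_card_seg_less:
  assumes "n < card (seg u)"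
  obtains v where "size v = size u" "v < u" "card (seg v) = n"
proof -
  have "(\<lambda>v. card (seg v)) ` seg u = {..<card (seg u)}"
  proof (rule card_subset_eq)
    show "(\<lambda>v. card (seg v)) ` seg u \<subseteq> {..<card (seg u)}"
    proof (intro image_subsetI)
      fix v assume "v \<in> seg u"
      then show "card (seg v) \<in> {..<card (seg u)}"
        by (simp add: card_seg_less_iff seg_def[of u] card_seg_less[of v u, unfolded seg_def[of u]])
    qed
    have "inj_on (\<lambda>v. card (seg v)) (seg u)"
      by (auto simp: inj_on_def seg_def[of u] card_seg_eq_iff)
    then show "card ((\<lambda>v. card (seg v)) ` seg u) = card {..<card (seg u)}"
      by (simp add: card_image)
  qed simp
  then have "n \<in> (\<lambda>v. card (seg v)) ` seg u" using assms by simp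
  then obtain v where "v \<in> seg u" "card (seg v) = n" by blast
  then show ?thesis using that unfolding seg_def[of u] by blast
qed

text \<open>A multiset below \<open>add_mset m u\<close> of its size either avoids \<open>m\<close>,
  and is then any multiset on the numbers below \<open>m\<close>, or is \<open>m\<close> added to a
  member of \<open>seg u\<close>. The first kind contributes the top binomial coefficient of the
  expansion.\<close>

lemma card_seg_add_max:
  assumes "\<And>y. y \<in># u \<Longrightarrow> y \<le> m"
  shows "card (seg (add_mset m u)) = ((m + size u) choose (Suc (size u))) + card (seg u)"
proof -
  have "seg (add_mset m u) = multisets_of_size {..<m} (Suc (size u)) \<union> add_mset m ` seg u"
    (is "_ = ?A \<union> ?B")
  proof (intro subset_antisym subsetI)
    fix v assume "v \<in> seg (add_mset m u)"
    then have v: "size v = Suc (size u)" "v < add_mset m u" by (auto simp: seg_def)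
    have le: "x \<le> m" if "x \<in># v" for x
      using less_multiset_mem_bound[OF v(2) that, of m] assms by auto
    show "v \<in> ?A \<union> ?B"
    proof (cases "m \<in># v")
      case True
      then obtain w where "v = add_mset m w" by (metis insert_DiffM)
      then show ?thesis using v by (auto simp: seg_def)
    next
      case False
      then have "set_mset v \<subseteq> {..<m}" using le by (auto simp: le_less)
      then show ?thesis using v by (auto simp: multisets_of_size_def)
    qed
  next
    fix v assume "v \<in> ?A \<union> ?B"
    then show "v \<in> seg (add_mset m u)"
    proof
      assume "v \<in> ?A"
      then have "size v = Suc (size u)" "\<And>x. x \<in># v \<Longrightarrow> x < m"
        by (auto simp: multisets_of_size_def)
      then show ?thesis
        by (auto simp: seg_def intro!: ex_gt_imp_less_multiset)
    qed (auto simp: seg_def)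
  qed
  moreover have "?A \<inter> ?B = {}" by (auto simp: multisets_of_size_def)
  ultimately have "card (seg (add_mset m u)) = card ?A + card ?B"
    by (metis card_Un_disjoint finite_imageI finite_lessThan finite_multisets_of_size finite_seg)
  moreover have "card ?B = card (seg u)" by (rule card_image) (simp add: inj_on_def)
  ultimately show ?thesis by (simp add: card_multisets_of_size)
qed

section \<open>Binomial expansions read off sorted multisets\<close>

definition ascending :: "nat \<Rightarrow> (nat \<Rightarrow> nat) \<Rightarrow> nat multiset" where
  "ascending d a = image_mset a (mset_set {1..d})"

lemma size_ascending [simp]: "size (ascending d a) = d"
  by (simp add: ascending_def)

lemma ascending_Suc: "ascending (Suc d) a = add_mset (a (Suc d)) (ascending d a)"
  by (simp add: ascending_def atLeastAtMostSuc_conv)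

text \<open>Peeling off largest entries produces the summands from the top down. Positions are
  counted from 1 so that the position of an entry is the lower index of its binomial
  coefficient.\<close>

lemma card_seg_ascending:
  assumes "mono_on {1..d} a"
  shows "card (seg (ascending d a)) = (\<Sum>i=1..d. (a i + i - 1) choose i)"
  using assms
proof (induction d)
  case 0
  then show ?case by (simp add: ascending_def seg_empty)
next
  case (Suc d)
  have "y \<le> a (Suc d)" if "y \<in># ascending d a" for y
    using that mono_onD[OF Suc.prems] by (auto simp: ascending_def)
  moreover have "mono_on {1..d} a" using Suc.prems by (rule mono_on_subset) auto
  ultimately show ?case using Suc.IH by (simp add: ascending_Suc card_seg_add_max)
qed

lemma ex_ascending:
  obtains a where "mono_on {1..size u} a" "u = ascending (size u) a"
proof
  let ?l = "sorted_list_of_multiset u"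
  have len: "length ?l = size u" by (metis mset_sorted_list_of_multiset size_mset)
  show "mono_on {1..size u} (\<lambda>i. ?l ! (i - 1))"
    using sorted_sorted_list_of_multiset[of u] len
    by (auto simp: mono_on_def intro!: sorted_nth_mono)
  have "mset_set {1..size u} = image_mset Suc (mset_set {0..<size u})"
    by (subst image_mset_mset_set) (auto simp: image_Suc_atLeastLessThan atLeastLessThanSuc_atLeastAtMost)
  then have "ascending (size u) (\<lambda>i. ?l ! (i - 1)) = image_mset ((!) ?l) (mset [0..<length ?l])"
    by (simp add: ascending_def multiset.map_comp o_def len)
  also have "\<dots> = u" by (metis map_nth mset_map mset_sorted_list_of_multiset)
  finally show "u = ascending (size u) (\<lambda>i. ?l ! (i - 1))" by simp
qed

lemma card_seg_ascending_add_zero: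
  assumes "mono_on {1..d} a"
  shows "card (seg (add_mset 0 (ascending d a))) = (\<Sum>i=1..d. (a i + i) choose (i + 1))"
proof -
  \<comment> \<open>The added 0 takes position 1 and moves every other entry up by one, which raises
    both indices of its binomial coefficient by one; the 0 itself contributes nothing.\<close>
  let ?a = "\<lambda>i. if i \<le> 1 then 0 else a (i - 1)"
  have "add_mset 0 (ascending d a) = ascending (Suc d) ?a"
  proof -
    have "{1..Suc d} = insert 1 (Suc ` {1..d})" by (auto simp flip: image_Suc_atLeastAtMost)
    then have "mset_set {1..Suc d} = add_mset 1 (image_mset Suc (mset_set {1..d}))"
      by (simp add: image_mset_mset_set)
    then show ?thesis
      by (auto simp: ascending_def multiset.map_comp o_def intro!: image_mset_cong)
  qed
  moreover have "mono_on {1..Suc d} ?a" 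
  proof (rule mono_onI)
    fix i j assume "i \<in> {1..Suc d}" "j \<in> {1..Suc d}" "i \<le> j"
    then show "?a i \<le> ?a j" by (auto intro!: mono_onD[OF assms])
  qed
  ultimately have "card (seg (add_mset 0 (ascending d a))) = (\<Sum>i=1..Suc d. (?a i + i - 1) choose i)"
    by (simp add: card_seg_ascending)
  also have "\<dots> = (\<Sum>i=1..d. (a i + i) choose (i + 1))"
    by (simp add: sum.atLeast_Suc_atMost sum.shift_bounds_cl_Suc_ivl del: sum.cl_ivl_Suc)
  finally show ?thesis .
qed

text \<open>The binomial expansion of the number of multisets below \<open>a\<^sub>1 \<le> \<dots> \<le> a\<^sub>d\<close> has \<open>k\<^sub>i = a\<^sub>i + i - 1\<close>;
  the entries with \<open>a\<^sub>i = 0\<close> are those below \<open>\<delta>\<close>.\<close>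

lemma binomial_expansion_seg:
  assumes "size u = d" "binomial_expansion (card (seg u)) d \<delta> k"
  shows "(\<Sum>i=\<delta>..d. (k i + 1) choose (i + 1)) = card (seg (add_mset 0 u))"
proof -
  have \<delta>: "1 \<le> \<delta>" "\<delta> \<le> d" and k: "strict_mono_on {\<delta>..d} k" "\<delta> \<le> k \<delta>"
    and eq: "card (seg u) = (\<Sum>i=\<delta>..d. k i choose i)"
    using assms(2) by (auto simp: binomial_expansion_def)
  define a where "a = (\<lambda>i. if i < \<delta> then 0 else k i + 1 - i)"
  \<comment> \<open>A strictly increasing sequence of integers gains at least one per index, so
    \<open>k i - i\<close> is weakly increasing and nonnegative from \<delta> on; the subtraction in
    \<open>a\<close> never truncates.\<close>
  have step: "k i + (j - i) \<le> k j" if "\<delta> \<le> i" "i \<le> j" "j \<le> d" for i j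
    using that(2,3)
  proof (induction j rule: dec_induct)
    case (step j)
    have "k j < k (Suc j)" using k(1) that step by (auto simp: strict_mono_on_def)
    then show ?case using step by simp
  qed simp
  have ge: "i \<le> k i" if "\<delta> \<le> i" "i \<le> d" for i
    using step[of \<delta> i] that k(2) by simp
  have mono: "mono_on {1..d} a"
  proof (rule mono_onI)
    fix i j assume "i \<in> {1..d}" "j \<in> {1..d}" "i \<le> j"
    then show "a i \<le> a j" using step[of i j] by (auto simp: a_def)
  qed
  have split: "(\<Sum>i=1..d. f i) = (\<Sum>i=\<delta>..d. f i)" if "\<And>i. 1 \<le> i \<Longrightarrow> i < \<delta> \<Longrightarrow> f i = (0::nat)" for f
    using \<delta> that by (intro sum.mono_neutral_right) auto
  have "card (seg (ascending d a)) = card (seg u)"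
    unfolding card_seg_ascending[OF mono] eq
    by (subst split) (auto simp: a_def ge le_SucI intro!: sum.cong)
  \<comment> \<open>Ranks determine multisets of a given size, so every expansion of this number
    comes from the sorted form of \<open>u\<close>. This is the uniqueness of the expansion.\<close>
  then have "ascending d a = u" using assms(1) by (simp add: card_seg_eq_iff)
  moreover have "card (seg (add_mset 0 (ascending d a))) = (\<Sum>i=\<delta>..d. (k i + 1) choose (i + 1))"
    unfolding card_seg_ascending_add_zero[OF mono]
    by (subst split) (auto simp: a_def ge Suc_diff_le intro!: sum.cong)
  ultimately show ?thesis by simp
qed

lemma ex_binomial_expansion_seg:
  assumes "card (seg u) \<noteq> 0"
  shows "\<exists>\<delta> k. binomial_expansion (card (seg u)) (size u) \<delta> k"
proof -
  let ?d = "size u"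
  obtain a where mono: "mono_on {1..?d} a" and u: "u = ascending ?d a" by (rule ex_ascending)
  have eq: "card (seg u) = (\<Sum>i=1..?d. (a i + i - 1) choose i)"
    using card_seg_ascending[OF mono] u by simp
  let ?P = "\<lambda>i. 1 \<le> i \<and> i \<le> ?d \<and> a i \<noteq> 0"
  have "\<exists>i. ?P i"
  proof (rule ccontr)
    assume "\<nexists>i. ?P i"
    then have "card (seg u) = 0" unfolding eq by (intro sum.neutral) auto
    then show False using assms by simp
  qed
  \<comment> \<open>Entries equal to 0 contribute \<open>(i - 1) choose i\<close>, which vanishes;
    starting at the first nonzero entry yields the required bound
    \<open>\<delta> \<le> k \<delta>\<close>.\<close>
  define \<delta> where "\<delta> = (LEAST i. ?P i)"
  have \<delta>: "?P \<delta>" using \<open>\<exists>i. ?P i\<close> unfolding \<delta>_def by (rule LeastI_ex)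
  have zero: "a i = 0" if "1 \<le> i" "i < \<delta>" for i
    using not_less_Least[of i ?P] that \<delta> unfolding \<delta>_def[symmetric] by auto
  have pos: "a \<delta> \<le> a i" if "\<delta> \<le> i" "i \<le> ?d" for i
    using mono \<delta> that by (auto simp: mono_on_def)
  have "binomial_expansion (card (seg u)) ?d \<delta> (\<lambda>i. a i + i - 1)"
    unfolding binomial_expansion_def
  proof (intro conjI)
    show "strict_mono_on {\<delta>..?d} (\<lambda>i. a i + i - 1)"
    proof (rule strict_mono_onI)
      fix i j assume ij: "i \<in> {\<delta>..?d}" "j \<in> {\<delta>..?d}" "i < j"
      then have "a i \<le> a j" using mono \<delta> by (auto simp: mono_on_def)
      then show "a i + i - 1 < a j + j - 1" using ij \<delta> by auto
    qed
    show "card (seg u) = (\<Sum>i=\<delta>..?d. (a i + i - 1) choose i)"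
      unfolding eq using \<delta> zero by (intro sum.mono_neutral_right) auto
  qed (use \<delta> in auto)
  then show ?thesis by blast
qed

text \<open>All expansions of the rank of \<open>u\<close> have the same shifted sum, so any one of
  them settles the definite description. Rank 0 falls under the default value, and removing a
  minimum shows that \<open>seg (add_mset 0 u)\<close> is then empty.\<close>

theorem binomial_shift_card_seg: "binomial_shift (card (seg u)) (size u) = card (seg (add_mset 0 u))"
proof (cases "card (seg u) = 0")
  case True
  have "seg (add_mset 0 u) = {}"
  proof (rule ccontr)
    assume "seg (add_mset 0 u) \<noteq> {}"
    then obtain v where v: "size v = Suc (size u)" "v < add_mset 0 u" by (auto simp: seg_def)
    then have "v \<noteq> {#}" by auto
    then have m: "Min_mset v \<in># v" by simp
    then have eq: "v = add_mset (Min_mset v) (v - {#Min_mset v#})" by simp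
    then have "add_mset (Min_mset v) (v - {#Min_mset v#}) < add_mset 0 u" using v by simp
    moreover have "size (v - {#Min_mset v#}) = size u" using v m by (simp add: size_Diff_singleton)
    ultimately have "v - {#Min_mset v#} \<in> seg u"
      by (subst (asm) add_min_less_add_zero_iff) (auto simp: seg_def dest: in_diffD)
    then show False using True by auto
  qed
  then show ?thesis using True by (simp add: binomial_shift_def)
next
  case False
  obtain \<delta> k where \<delta>: "binomial_expansion (card (seg u)) (size u) \<delta> k"
    using ex_binomial_expansion_seg[OF False] by blast
  have "(THE m. \<exists>\<delta> k. binomial_expansion (card (seg u)) (size u) \<delta> k \<and>
      m = (\<Sum>i=\<delta>..size u. (k i + 1) choose (i + 1))) = card (seg (add_mset 0 u))"
    
  proof (rule the_equality)
    show "m = card (seg (add_mset 0 u))" if "\<exists>\<delta> k. binomial_expansion (card (seg u)) (size u) \<delta> k \<and>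
      m = (\<Sum>i=\<delta>..size u. (k i + 1) choose (i + 1))" for m
      using that binomial_expansion_seg[OF refl, of u] by blast
  qed (use \<delta> binomial_expansion_seg[OF refl, of u, symmetric] in blast)
  then show ?thesis using False by (simp add: binomial_shift_def)
qed

text \<open>The multiset with one entry \<open>Suc n\<close> and all others 0 has rank at least
  \<open>(n + d) choose d\<close>, which exceeds \<open>n\<close>; smaller ranks are attained below
  it.\<close>

lemma ex_card_seg:
  assumes "d \<ge> 1"
  obtains u where "size u = d" "card (seg u) = n"
proof -
  have mono: "mono_on {1..d} (\<lambda>i. if i = d then Suc n else 0)" by (auto simp: mono_on_def)
  have "n < (n + d) choose d"
  proof -
    have "n < (n + 1) choose n" by simp
    also have "\<dots> \<le> (n + d) choose n" using assms by (intro binomial_right_mono) auto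
    also have "\<dots> = (n + d) choose d" using binomial_symmetric[of n "n + d"] by simp
    finally show ?thesis .
  qed
  also have "\<dots> = (\<Sum>i\<in>{d}. ((if i = d then Suc n else 0) + i - 1) choose i)" by simp
  also have "\<dots> \<le> card (seg (ascending d (\<lambda>i. if i = d then Suc n else 0)))"
    unfolding card_seg_ascending[OF mono] using assms by (intro sum_mono2) auto
  finally show ?thesis by (rule ex_card_seg_less) (auto intro: that)
qed

section \<open>Macaulay's bound\<close>

definition shadow :: "'x multiset set \<Rightarrow> 'x multiset set" where
  "shadow A = {v. \<exists>x. add_mset x v \<in> A}"

lemma finite_shadow: "finite A \<Longrightarrow> finite (shadow A)"
proof -
  assume "finite A"
  have "shadow A \<subseteq> (\<Union>u\<in>A. {v. v \<subseteq># u})"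
  proof
    fix v assume "v \<in> shadow A"
    then obtain x where "add_mset x v \<in> A" by (auto simp: shadow_def)
    moreover have "v \<subseteq># add_mset x v" by simp
    ultimately show "v \<in> (\<Union>u\<in>A. {v. v \<subseteq># u})" by blast
  qed
  then show ?thesis
    by (rule finite_subset) (simp add: \<open>finite A\<close> finite_submultisets)
qed

text \<open>Removing the maximum, which is at least the cardinality minus one, gives both claims by
  induction. The sum of positions becomes a measure that compression lowers on every fibre with a
  gap.\<close>

lemma sum_lessThan_card_le:
  fixes F :: "nat set"
  assumes "finite F"
  shows "\<Sum>{..<card F} \<le> \<Sum>F" "\<Sum>F = \<Sum>{..<card F} \<Longrightarrow> F = {..<card F}"
proof -
  have "\<Sum>{..<card F} \<le> \<Sum>F \<and> (\<Sum>F = \<Sum>{..<card F} \<longrightarrow> F = {..<card F})"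
    using assms
  proof (induction "card F" arbitrary: F)
    case (Suc n)
    then have ne: "F \<noteq> {}" by auto
    let ?m = "Max F"
    have m: "?m \<in> F" using Suc ne by simp
    have F: "F \<subseteq> {..?m}" using Suc by auto
    have n: "n = card (F - {?m})" using Suc m by simp
    have "card F \<le> card {..?m}" by (rule card_mono[OF _ F]) simp
    then have "n \<le> ?m" using Suc by simp
    moreover have "\<Sum>F = ?m + \<Sum>(F - {?m})" using Suc m by (simp add: sum.remove)
    moreover have "\<Sum>{..<card F} = n + \<Sum>{..<n}" by (simp flip: Suc(2))
    moreover have "\<Sum>{..<n} \<le> \<Sum>(F - {?m})" using Suc(1)[OF n] Suc n by simp
    moreover have "F = {..<card F}" if "?m = n"
      by (rule card_subset_eq) (use F that Suc(2) in \<open>auto simp: lessThan_Suc_atMost simp flip: Suc(2)\<close>)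
    ultimately show ?case by auto
  qed auto
  then show "\<Sum>{..<card F} \<le> \<Sum>F" "\<Sum>F = \<Sum>{..<card F} \<Longrightarrow> F = {..<card F}" by auto
qed

section \<open>Compression between the variables 0 and j\<close>

context
  fixes j :: nat
  assumes j: "j \<noteq> 0"
begin

text \<open>The key is what an exchange of copies of 0 and \<open>j\<close> leaves unchanged. The
  multisets with a given key form a chain indexed by the multiplicity of \<open>j\<close>.\<close>

definition outer_key :: "nat multiset \<Rightarrow> nat multiset \<times> nat" where
  "outer_key u = (filter_mset (\<lambda>x. x \<noteq> 0 \<and> x \<noteq> j) u, count u 0 + count u j)"

definition fibre_elt :: "nat multiset \<times> nat \<Rightarrow> nat \<Rightarrow> nat multiset" where
  "fibre_elt p i = fst p + replicate_mset (snd p - i) 0 + replicate_mset i j"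

definition fibre :: "nat multiset set \<Rightarrow> nat multiset \<times> nat \<Rightarrow> nat set" where
  "fibre A p = {i. i \<le> snd p \<and> fibre_elt p i \<in> A}"

text \<open>Each chain keeps as many members as it had, moved to the end where \<open>j\<close> is
  rarest.\<close>

definition compress :: "nat multiset set \<Rightarrow> nat multiset set" where
  "compress A = {u. count u j < card (fibre A (outer_key u))}"

lemma finite_fibre [simp]: "finite (fibre A p)"
  by (simp add: fibre_def)

lemma card_fibre_le: "card (fibre A p) \<le> Suc (snd p)"
proof -
  have "card (fibre A p) \<le> card {..snd p}" by (rule card_mono) (auto simp: fibre_def)
  then show ?thesis by simp
qed

lemma fibre_elt_outer_key [simp]: "fibre_elt (outer_key u) (count u j) = u"
  using j by (auto simp: fibre_elt_def outer_key_def multiset_eq_iff)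

lemma count_fibre_elt: "p \<in> range outer_key \<Longrightarrow> i \<le> snd p \<Longrightarrow> count (fibre_elt p i) j = i"
  using j by (auto simp: fibre_elt_def outer_key_def)

lemma outer_key_fibre_elt: "p \<in> range outer_key \<Longrightarrow> i \<le> snd p \<Longrightarrow> outer_key (fibre_elt p i) = p"
  using j by (auto simp: fibre_elt_def outer_key_def multiset_eq_iff)

lemma size_outer_key: "size u = size (fst (outer_key u)) + snd (outer_key u)"
proof -
  have "size u = size (fibre_elt (outer_key u) (count u j))" by simp
  also have "\<dots> = size (fst (outer_key u)) + snd (outer_key u)"
    by (simp add: fibre_elt_def del: fibre_elt_outer_key) (simp add: outer_key_def)
  finally show ?thesis .
qed

lemma key_class: 
  assumes "p \<in> range outer_key"
  shows "{u \<in> A. outer_key u = p} = fibre_elt p ` fibre A p"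
proof (intro subset_antisym subsetI)
  fix u assume "u \<in> {u \<in> A. outer_key u = p}"
  then have "u \<in> A" "p = outer_key u" by auto
  then show "u \<in> fibre_elt p ` fibre A p"
    by (intro image_eqI[of _ _ "count u j"]) (auto simp: fibre_def, simp add: outer_key_def)
next
  fix u assume "u \<in> fibre_elt p ` fibre A p"
  then show "u \<in> {u \<in> A. outer_key u = p}"
    using outer_key_fibre_elt[OF assms] by (auto simp: fibre_def)
qed

lemma inj_on_fibre_elt: "p \<in> range outer_key \<Longrightarrow> inj_on (fibre_elt p) (fibre A p)"
  by (rule inj_onI) (metis (mono_tags, lifting) count_fibre_elt fibre_def mem_Collect_eq)

lemma fibre_compress:
  assumes "p \<in> range outer_key"
  shows "fibre (compress A) p = {..<card (fibre A p)}"
proof -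
  have "fibre (compress A) p = {i. i \<le> snd p \<and> i < card (fibre A p)}"
    unfolding fibre_def[of "compress A" p]
    by (intro Collect_cong conj_cong refl)
      (simp add: compress_def count_fibre_elt[OF assms] outer_key_fibre_elt[OF assms])
  also have "\<dots> = {..<card (fibre A p)}"
    using card_fibre_le[of A p] by (intro subset_antisym subsetI) auto
  finally show ?thesis .
qed

text \<open>\<open>K\<close> may contain keys that \<open>A\<close> misses, so that the sums for two
  sets can run over the same classes and be compared term by term.\<close>

lemma sum_by_key:
  fixes f :: "nat multiset \<Rightarrow> nat"
  assumes "finite A" "finite K" "outer_key ` A \<subseteq> K" "K \<subseteq> range outer_key"
  shows "(\<Sum>u\<in>A. f u) = (\<Sum>p\<in>K. \<Sum>i\<in>fibre A p. f (fibre_elt p i))"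
proof -
  have "(\<Sum>u\<in>A. f u) = (\<Sum>p\<in>K. \<Sum>u\<in>{u\<in>A. outer_key u = p}. f u)"
    using assms by (intro sum.group[symmetric]) auto
  also have "\<dots> = (\<Sum>p\<in>K. \<Sum>i\<in>fibre A p. f (fibre_elt p i))"
    using assms(4) by (intro sum.cong refl) (subst key_class, auto simp: sum.reindex inj_on_fibre_elt)
  finally show ?thesis .
qed

lemma compress_keyD:
  assumes "u \<in> compress A"
  obtains i where "i \<le> snd (outer_key u)" "fibre_elt (outer_key u) i \<in> A"
proof -
  have "fibre A (outer_key u) \<noteq> {}" using assms by (auto simp: compress_def)
  then show ?thesis using that by (auto simp: fibre_def)
qed

lemma outer_key_compress: "outer_key ` compress A \<subseteq> outer_key ` A"
proof
  fix p assume "p \<in> outer_key ` compress A"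
  then obtain u where u: "u \<in> compress A" "p = outer_key u" by auto
  then obtain i where "i \<le> snd p" "fibre_elt p i \<in> A" by (metis compress_keyD)
  then show "p \<in> outer_key ` A"
    using u by (intro image_eqI[of _ _ "fibre_elt p i"]) (simp_all add: outer_key_fibre_elt)
qed

lemma finite_compress:
  assumes "finite A"
  shows "finite (compress A)"
proof -
  have "compress A \<subseteq> (\<Union>p\<in>outer_key ` A. fibre_elt p ` {..snd p})"
  proof
    fix u assume "u \<in> compress A"
    then have "outer_key u \<in> outer_key ` A" using outer_key_compress by blast
    moreover have "u \<in> fibre_elt (outer_key u) ` {..snd (outer_key u)}"
      by (rule image_eqI[of _ _ "count u j"]) (simp_all, simp add: outer_key_def)
    ultimately show "u \<in> (\<Union>p\<in>outer_key ` A. fibre_elt p ` {..snd p})" by blast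
  qed
  then show ?thesis by (rule finite_subset) (simp add: assms)
qed

lemma card_compress:
  assumes "finite A"
  shows "card (compress A) = card A"
proof -
  have "(\<Sum>u\<in>compress A. 1) = (\<Sum>p\<in>outer_key ` A. \<Sum>i\<in>fibre (compress A) p. (1::nat))"
    by (rule sum_by_key) (use assms outer_key_compress in \<open>auto simp: finite_compress\<close>)
  also have "\<dots> = (\<Sum>p\<in>outer_key ` A. \<Sum>i\<in>fibre A p. 1)"
  proof (rule sum.cong[OF refl])
    fix p assume "p \<in> outer_key ` A"
    then have "p \<in> range outer_key" by blast
    then show "(\<Sum>i\<in>fibre (compress A) p. 1::nat) = (\<Sum>i\<in>fibre A p. 1)"
      by (simp add: fibre_compress)
  qed
  also have "\<dots> = (\<Sum>u\<in>A. 1)"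
    by (rule sum_by_key[symmetric]) (use assms in auto)
  finally show ?thesis by simp
qed

text \<open>The two multisets lie in one class, whose fibre contains a number but misses its
  predecessor and so is no initial segment. Within a class the sum of entries is affine in the
  position with slope \<open>j\<close>; the total over this class drops strictly and over no class
  rises.\<close>

lemma sum_mset_compress_less:
  assumes "finite A" "add_mset j w \<in> A" "add_mset 0 w \<notin> A"
  shows "(\<Sum>u\<in>compress A. \<Sum>\<^sub># u) < (\<Sum>u\<in>A. \<Sum>\<^sub># u)"
proof -
  have sum_elt: "(\<Sum>i\<in>F. \<Sum>\<^sub># (fibre_elt p i)) = card F * \<Sum>\<^sub># (fst p) + j * \<Sum>F" for p F
    by (simp add: fibre_elt_def sum.distrib sum_distrib_left sum_mset_replicate_mset mult.commute)
  let ?g = "\<lambda>A p. \<Sum>i\<in>fibre A p. \<Sum>\<^sub># (fibre_elt p i)"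
  have le: "?g (compress A) p \<le> ?g A p" if "p \<in> range outer_key" for p
    unfolding sum_elt fibre_compress[OF that] using sum_lessThan_card_le(1)[of "fibre A p"] by simp
  let ?p = "outer_key (add_mset j w)"
  have "?p = outer_key (add_mset 0 w)" using j by (simp add: outer_key_def)
  then have e0: "fibre_elt ?p (count w j) = add_mset 0 w"
    using fibre_elt_outer_key[of "add_mset 0 w"] j by simp
  have e1: "fibre_elt ?p (Suc (count w j)) = add_mset j w"
    using fibre_elt_outer_key[of "add_mset j w"] by simp
  have "Suc (count w j) \<in> fibre A ?p" "count w j \<notin> fibre A ?p"
    using assms e0 e1 by (auto simp: fibre_def) (simp add: outer_key_def)
  then have "fibre A ?p \<noteq> {..<card (fibre A ?p)}" by (metis Suc_lessD lessThan_iff)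
  then have "\<Sum>{..<card (fibre A ?p)} < \<Sum>(fibre A ?p)"
    using sum_lessThan_card_le[of "fibre A ?p"] by force
  then have less: "?g (compress A) ?p < ?g A ?p"
    unfolding sum_elt by (subst fibre_compress, simp, subst fibre_compress, simp) (use j in simp)
  have "(\<Sum>u\<in>compress A. \<Sum>\<^sub># u) = (\<Sum>p\<in>outer_key ` A. ?g (compress A) p)"
    by (rule sum_by_key) (use assms outer_key_compress in \<open>auto simp: finite_compress\<close>)
  also have "\<dots> < (\<Sum>p\<in>outer_key ` A. ?g A p)"
  proof (rule sum_strict_mono_ex1)
    show "\<exists>p\<in>outer_key ` A. ?g (compress A) p < ?g A p" using less assms(2) by blast
  qed (use assms le in auto)
  also have "\<dots> = (\<Sum>u\<in>A. \<Sum>\<^sub># u)"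
    by (rule sum_by_key[symmetric]) (use assms in auto)
  finally show ?thesis .
qed

text \<open>The shadow of an initial segment of a fibre \<open>{0..t+1}\<close> is an initial segment of \<open>{0..t}\<close>, so on
  each fibre the shadow of the compression is the longest of several initial segments, each no longer
  than the corresponding fibre of the original shadow.\<close>

lemma fibre_shadow_compress:
  assumes p: "p \<in> range outer_key"
  shows "card (fibre (shadow (compress A)) p) \<le> card (fibre (shadow A) p)"
proof -
  let ?c = "card (fibre (shadow A) p)"
  have "fibre (shadow (compress A)) p \<subseteq> {..<?c}"
  proof
    fix i assume "i \<in> fibre (shadow (compress A)) p"
    then obtain x where i: "i \<le> snd p" and x: "add_mset x (fibre_elt p i) \<in> compress A"
      by (auto simp: fibre_def shadow_def)
    let ?v = "fibre_elt p i"
    have v: "outer_key ?v = p" "count ?v j = i"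
      using p i by (simp_all add: outer_key_fibre_elt count_fibre_elt)
    show "i \<in> {..<?c}"
    proof (cases "x = 0 \<or> x = j")
      case False
      let ?q = "(add_mset x (fst p), snd p)"
      have "outer_key (add_mset x ?v) = ?q"
        using False v(1) by (auto simp: outer_key_def prod_eq_iff)
      then have "i < card (fibre A ?q)" using x False v(2) by (auto simp: compress_def)
      also have "\<dots> \<le> ?c"
        by (rule card_mono) (auto simp: fibre_def shadow_def fibre_elt_def)
      finally show ?thesis by simp
    next
      case True
      let ?q = "(fst p, Suc (snd p))"
      let ?F = "fibre A ?q"
      have key: "outer_key (add_mset x ?v) = ?q"
        using True v(1) j by (auto simp: outer_key_def prod_eq_iff)
      have "count (add_mset x ?v) j < card ?F" using x by (simp add: compress_def key)
      then have "i < card ?F" using v(2) by (simp split: if_splits)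
      have down: "k \<in> fibre (shadow A) p" if "k \<in> ?F" "k \<le> snd p" for k
      proof -
        have "fibre_elt ?q k = add_mset 0 (fibre_elt p k)"
          using that by (simp add: fibre_elt_def Suc_diff_le)
        then show ?thesis using that by (auto simp: fibre_def shadow_def)
      qed
      have left: "k \<in> fibre (shadow A) p" if "Suc k \<in> ?F" for k
      proof -
        have "fibre_elt ?q (Suc k) = add_mset j (fibre_elt p k)" by (simp add: fibre_elt_def)
        then show ?thesis using that by (auto simp: fibre_def shadow_def)
      qed
      show ?thesis
      proof (cases "?F = {..Suc (snd p)}")
        case True
        then have "{..snd p} \<subseteq> fibre (shadow A) p" using down by auto
        then have "card {..snd p} \<le> ?c" by (intro card_mono) auto
        then show ?thesis using i by simp
      next
        case False
        then obtain e where e: "e \<le> Suc (snd p)" "e \<notin> ?F" by (auto simp: fibre_def)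
        \<comment> \<open>The missing position \<open>e\<close> is closed up: below it a 0 is
          dropped and the position stays, above it a \<open>j\<close> is dropped and the position
          falls by one. This injects the fibre into that of the shadow.\<close>
        let ?h = "\<lambda>k. if k < e then k else k - 1"
        have "inj_on ?h ?F"
        proof (rule inj_onI)
          fix k l assume "k \<in> ?F" "l \<in> ?F" "?h k = ?h l"
          moreover from this have "k \<noteq> e" "l \<noteq> e" using e by auto
          ultimately show "k = l" by (auto split: if_splits)
        qed
        moreover have "?h ` ?F \<subseteq> fibre (shadow A) p"
        proof (rule image_subsetI)
          fix k assume k: "k \<in> ?F"
          then have "k \<noteq> e" using e by auto
          show "?h k \<in> fibre (shadow A) p"
          proof (cases "k < e")
            case True
            then show ?thesis using k e by (auto intro: down)
          next
            case False
            then obtain l where "k = Suc l" using \<open>k \<noteq> e\<close> by (cases k) auto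
            then show ?thesis using False k left[of l] by auto
          qed
        qed
        ultimately have "card ?F \<le> ?c" by (intro card_inj_on_le[of ?h]) auto
        then show ?thesis using \<open>i < card ?F\<close> by simp
      qed
    qed
  qed
  then have "card (fibre (shadow (compress A)) p) \<le> card {..<?c}" by (intro card_mono) auto
  then show ?thesis by simp
qed

lemma card_shadow_compress:
  assumes "finite A"
  shows "card (shadow (compress A)) \<le> card (shadow A)"
proof -
  let ?K = "outer_key ` shadow A \<union> outer_key ` shadow (compress A)"
  have fin: "finite (shadow A)" "finite (shadow (compress A))"
    using assms by (simp_all add: finite_shadow finite_compress)
  have "(\<Sum>u\<in>shadow (compress A). 1) = (\<Sum>p\<in>?K. \<Sum>i\<in>fibre (shadow (compress A)) p. (1::nat))"
    by (rule sum_by_key) (use fin in auto)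
  also have "\<dots> \<le> (\<Sum>p\<in>?K. \<Sum>i\<in>fibre (shadow A) p. 1)"
    by (rule sum_mono) (use fibre_shadow_compress[of _ A] in auto)
  also have "\<dots> = (\<Sum>u\<in>shadow A. 1)"
    by (rule sum_by_key[symmetric]) (use fin in auto)
  finally show ?thesis by simp
qed

lemma compress_subset:
  assumes "A \<subseteq> multisets_of_size {..<b} d" "j < b"
  shows "compress A \<subseteq> multisets_of_size {..<b} d"
proof
  fix u assume "u \<in> compress A"
  then obtain i where i: "i \<le> snd (outer_key u)" "fibre_elt (outer_key u) i \<in> A" by (rule compress_keyD)
  let ?v = "fibre_elt (outer_key u) i"
  have key: "outer_key ?v = outer_key u" using i by (simp add: outer_key_fibre_elt)
  have v: "set_mset ?v \<subseteq> {..<b}" "size ?v = d" using i assms by (auto simp: multisets_of_size_def)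
  have "size u = d" using size_outer_key[of u] size_outer_key[of ?v] key v by simp
  moreover have "x < b" if "x \<in># u" for x
  proof (cases "x = 0 \<or> x = j")
    case False
    then have "x \<in># fst (outer_key u)" using that by (simp add: outer_key_def)
    then have "x \<in># ?v" by (simp add: fibre_elt_def)
    then show ?thesis using v by auto
  qed (use assms in auto)
  ultimately show "u \<in> multisets_of_size {..<b} d" by (auto simp: multisets_of_size_def)
qed

end

section \<open>Stable sets and the induction for the bound\<close>

definition zero_stable :: "nat multiset set \<Rightarrow> bool" where
  "zero_stable A \<longleftrightarrow> (\<forall>j w. add_mset j w \<in> A \<longrightarrow> add_mset 0 w \<in> A)"

text \<open>Among the admissible sets, one with the least total sum of entries is stable, since
  otherwise compression at an offending \<open>j\<close> would lower the sum.\<close>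

lemma ex_zero_stable:
  assumes "A \<subseteq> multisets_of_size {..<b} d"
  obtains A' where "A' \<subseteq> multisets_of_size {..<b} d" "card A' = card A"
    "card (shadow A') \<le> card (shadow A)" "zero_stable A'"
proof -
  let ?P = "\<lambda>A'. A' \<subseteq> multisets_of_size {..<b} d \<and> card A' = card A \<and> card (shadow A') \<le> card (shadow A)"
  obtain A' where A': "?P A'" and least: "\<And>B. ?P B \<Longrightarrow> (\<Sum>u\<in>A'. \<Sum>\<^sub># u) \<le> (\<Sum>u\<in>B. \<Sum>\<^sub># u)"
    using ex_has_least_nat[of ?P A "\<lambda>A. \<Sum>u\<in>A. \<Sum>\<^sub># u"] assms by blast
  have fin: "finite A'" using A' by (auto intro: finite_subset[OF _ finite_multisets_of_size])
  have "zero_stable A'"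
    unfolding zero_stable_def
  proof (intro allI impI, rule ccontr)
    fix j w assume jw: "add_mset j w \<in> A'" "add_mset 0 w \<notin> A'"
    then have j: "j \<noteq> 0" by metis
    have "add_mset j w \<in> multisets_of_size {..<b} d" using jw A' by blast
    then have "j < b" by (simp add: multisets_of_size_def)
    then have "?P (compress j A')"
      using A' card_compress[OF j fin] card_shadow_compress[OF j fin] compress_subset[OF j, of A' b d]
      by linarith
    then show False using least[of "compress j A'"] sum_mset_compress_less[OF j fin jw] by linarith
  qed
  then show ?thesis using A' that by blast
qed

text \<open>The dropped variable may always be taken to be 0. The shadow is then counted by the
  members containing 0, and \<open>card_zero_split\<close> leaves only those avoiding 0 to be
  estimated.\<close>

lemma shadow_zero_stable:
  assumes "zero_stable A"
  shows "shadow A = {w. add_mset 0 w \<in> A}"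
  using assms by (auto simp: zero_stable_def shadow_def)

lemma zero_stable_shadow:
  assumes "zero_stable A"
  shows "zero_stable (shadow A)"
  unfolding zero_stable_def
proof (intro allI impI)
  fix j w assume "add_mset j w \<in> shadow A"
  then obtain x where "add_mset x (add_mset j w) \<in> A" by (auto simp: shadow_def)
  then have "add_mset j (add_mset x w) \<in> A" by (simp add: add_mset_commute)
  then have "add_mset 0 (add_mset x w) \<in> A" using assms by (simp add: zero_stable_def)
  then have "add_mset x (add_mset 0 w) \<in> A" by (simp add: add_mset_commute)
  then show "add_mset 0 w \<in> shadow A" by (auto simp: shadow_def)
qed

lemma card_zero_split:
  fixes A :: "nat multiset set"
  assumes "finite A"
  shows "card A = card {w. add_mset 0 w \<in> A} + card {w \<in> A. 0 \<notin># w}"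
proof -
  have "A = add_mset 0 ` {w. add_mset 0 w \<in> A} \<union> {w \<in> A. 0 \<notin># w}" (is "_ = ?B \<union> ?C")
    by (auto simp: image_iff) (metis insert_DiffM)
  moreover have "finite ?B" "finite ?C" using assms by (auto intro: finite_subset[OF _ assms])
  moreover have "?B \<inter> ?C = {}" by auto
  ultimately have "card A = card ?B + card ?C" by (metis card_Un_disjoint)
  moreover have "card ?B = card {w. add_mset 0 w \<in> A}" by (rule card_image) (simp add: inj_on_def)
  ultimately show ?thesis by simp
qed

lemma image_mset_strict_mono:
  fixes u v :: "'x::linorder multiset"
  assumes "strict_mono f" "u < v"
  shows "image_mset f u < image_mset (f :: _ \<Rightarrow> 'y::linorder) v"
proof -
  from assms(2) obtain e where e: "count u e < count v e" "\<And>y. e < y \<Longrightarrow> count u y = count v y"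
    by (rule less_multiset_pivot) blast
  have inj: "inj f" using assms(1) by (rule strict_mono_imp_inj_on)
  have c: "count (image_mset f w) (f x) = count w x" for w x
    by (induction w) (auto simp: inj_eq[OF inj])
  show ?thesis
  proof (rule less_multisetI_pivot[of _ "f e"])
    show "count (image_mset f u) (f e) < count (image_mset f v) (f e)" using e by (simp add: c)
    fix y assume y: "f e < y"
    show "count (image_mset f u) y = count (image_mset f v) y"
    proof (cases "y \<in> range f")
      case True
      then show ?thesis using y e assms(1) by (auto simp: c strict_mono_less)
    next
      case False
      then have "count (image_mset f w) y = 0" for w using count_inI[of "image_mset f w" y] by force
      then show ?thesis by simp
    qed
  qed
qed

lemma image_mset_strict_mono_iff:
  fixes u v :: "'x::linorder multiset" and f :: "'x \<Rightarrow> 'y::linorder"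
  assumes "strict_mono f"
  shows "image_mset f u < image_mset f v \<longleftrightarrow> u < v"
  using image_mset_strict_mono[OF assms, of u v] image_mset_strict_mono[OF assms, of v u]
  by (metis less_asym linorder_less_linear)

lemma image_mset_Suc_surj:
  assumes "0 \<notin># u"
  shows "image_mset Suc (image_mset (\<lambda>x. x - 1) u) = u"
proof -
  have "image_mset (Suc \<circ> (\<lambda>x. x - 1)) u = image_mset id u"
    using assms by (intro image_mset_cong) (metis Suc_pred' comp_apply gr0I id_apply)
  then show ?thesis by (simp add: multiset.map_comp)
qed

text \<open>Lowering all entries by one turns the zero-free members of an initial segment into an
  initial segment again. It ends at the least \<open>w\<close> whose shift is not below
  \<open>u\<close>.\<close>

lemma ex_seg_without_zero:
  obtains w where "size w = size u" "{v \<in> seg u. 0 \<notin># v} = image_mset Suc ` seg w"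
proof -
  let ?P = "\<lambda>w. size w = size u \<and> u \<le> image_mset Suc w"
  define w where "w = (LEAST w. ?P w)"
  have "u \<le> image_mset Suc u"
  proof (induction u)
    case (add x u)
    then show ?case by (simp add: add_mset_le_le_le)
  qed simp
  then have w: "?P w" unfolding w_def by (intro LeastI[of ?P u]) simp
  have least: "w \<le> v" if "?P v" for v unfolding w_def using that by (rule Least_le)
  have "image_mset Suc v < u \<longleftrightarrow> v < w" if "size v = size u" for v
  proof
    assume "image_mset Suc v < u"
    then have "image_mset Suc v < image_mset Suc w" using w by auto
    then show "v < w" by (simp add: image_mset_strict_mono_iff strict_mono_def)
  next
    assume "v < w"
    then show "image_mset Suc v < u" using least[of v] that by force
  qed
  then have *: "image_mset Suc v \<in> seg u \<longleftrightarrow> v \<in> seg w" for v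
    using w by (auto simp: seg_def)
  have "{v \<in> seg u. 0 \<notin># v} = image_mset Suc ` seg w"
  proof (intro subset_antisym subsetI)
    fix v assume "v \<in> {v \<in> seg u. 0 \<notin># v}"
    then obtain x where "v = image_mset Suc x" "v \<in> seg u"
      by (metis (mono_tags, lifting) image_mset_Suc_surj mem_Collect_eq)
    then show "v \<in> image_mset Suc ` seg w" using * by blast
  qed (auto simp: *)
  then show ?thesis using w that by blast
qed

lemma ex_remove_min:
  fixes u :: "'x::linorder multiset"
  assumes "u \<noteq> {#}"
  obtains m v where "u = add_mset m v" "\<And>y. y \<in># v \<Longrightarrow> m \<le> y"
proof -
  have "Min_mset u \<in># u" using assms by simp
  then show ?thesis
    by (intro that[of "Min_mset u" "u - {#Min_mset u#}"]) (auto dest: in_diffD)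
qed

text \<open>Removing a minimum from a member of \<open>seg (add_mset 0 w)\<close> gives a member of
  \<open>seg w\<close>, whose shift lies in \<open>seg u\<close>; the shifted minimum can be added
  back. This carries the bound in fewer variables to the zero-free part of a segment.\<close>

lemma seg_without_zero_add_zero:
  assumes "size w = size u" "{v \<in> seg u. 0 \<notin># v} = image_mset Suc ` seg w"
  shows "image_mset Suc ` seg (add_mset 0 w) \<subseteq> {v \<in> seg (add_mset 0 u). 0 \<notin># v}"
proof
  fix v assume "v \<in> image_mset Suc ` seg (add_mset 0 w)"
  then obtain y where v: "v = image_mset Suc y" and y: "size y = Suc (size w)" "y < add_mset 0 w"
    by (auto simp: seg_def)
  then have "y \<noteq> {#}" by auto
  then obtain m z where z: "y = add_mset m z" "\<And>x. x \<in># z \<Longrightarrow> m \<le> x" by (rule ex_remove_min) blast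
  then have "z \<in> seg w" using y add_min_less_add_zero_iff[of z w m] by (simp add: seg_def)
  then have "image_mset Suc z \<in> seg u" using assms(2) by blast
  then have "image_mset Suc y \<in> seg (add_mset 0 u)"
    using z add_min_less_add_zero_iff[of "image_mset Suc z" u "Suc m"] by (auto simp: seg_def)
  then show "v \<in> {v \<in> seg (add_mset 0 u). 0 \<notin># v}" using v by auto
qed

lemma seg_add_zero: "{w. add_mset 0 w \<in> seg (add_mset 0 u)} = seg u"
  by (auto simp: seg_def)

text \<open>Green's bound on the restriction to \<open>x\<^sub>0 = 0\<close>; for a stable set the restriction has
  \<open>card B - card (shadow B)\<close> elements, so the bound follows from Macaulay's bound one degree below.\<close>

lemma card_without_zero_le:
  assumes B: "zero_stable B" "B \<subseteq> multisets_of_size C (size u)" "finite C" "card B = card (seg u)"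
    and macaulay: "\<And>z. u \<noteq> {#} \<Longrightarrow> size u = Suc (size z) \<Longrightarrow> card (shadow B) \<le> card (seg z) \<Longrightarrow>
      card B \<le> card (seg (add_mset 0 z))"
  shows "card {w \<in> B. 0 \<notin># w} \<le> card {w \<in> seg u. 0 \<notin># w}"
proof (rule ccontr)
  assume "\<not> ?thesis"
  then have gt: "card {w \<in> seg u. 0 \<notin># w} < card {w \<in> B. 0 \<notin># w}" by simp
  have fin: "finite B" using B by (auto intro: finite_subset[OF _ finite_multisets_of_size])
  have "u \<noteq> {#}"
  proof
    assume "u = {#}"
    then have "B = {}" using B(4) fin by simp
    then show False using gt by simp
  qed
  then obtain m z where u: "u = add_mset m z" "\<And>y. y \<in># z \<Longrightarrow> m \<le> y" by (rule ex_remove_min) blast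
  \<comment> \<open>Both sets have equally many members, so an excess among those avoiding 0 is a
    deficit among those containing 0.\<close>
  have "card (shadow B) + card {w \<in> B. 0 \<notin># w} = card {w. add_mset 0 w \<in> seg u} + card {w \<in> seg u. 0 \<notin># w}"
    using card_zero_split[OF fin] card_zero_split[OF finite_seg, of u] B(4)
      shadow_zero_stable[OF B(1)] by simp
  then have less: "card (shadow B) < card {w. add_mset 0 w \<in> seg u}" using gt by simp
  show False
  proof (cases "m = 0")
    case True
    then have "card (shadow B) < card (seg z)" using less u seg_add_zero by simp
    then obtain z' where z': "size z' = size z" "z' < z" "card (seg z') = card (shadow B)"
      by (rule ex_card_seg_less)
    then have "card B \<le> card (seg (add_mset 0 z'))" using macaulay[of z'] u \<open>u \<noteq> {#}\<close> by simp
    also have "\<dots> < card (seg u)" using z' u True by (intro card_seg_less) auto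
    finally show False using B(4) by simp
  next
    case False
    \<comment> \<open>With \<open>m\<close> positive, whatever enters \<open>seg u\<close> on adding
      0 is at most \<open>z\<close>. The strict deficit then leaves at most
      \<open>card (seg z)\<close> elements in the shadow, and the bound at
      \<open>add_mset 0 z\<close>, which is below \<open>u\<close>, is contradictory.\<close>
    have "{w. add_mset 0 w \<in> seg u} \<subseteq> insert z (seg z)"
    proof
      fix w assume "w \<in> {w. add_mset 0 w \<in> seg u}"
      then have w: "size w = size z" "add_mset 0 w < add_mset m z" using u by (auto simp: seg_def)
      then have "\<not> z < w"
        using add_min_less_add_zero_iff[of z w m] u(2) by auto
      then show "w \<in> insert z (seg z)" using w by (auto simp: seg_def)
    qed
    then have "card {w. add_mset 0 w \<in> seg u} \<le> card (insert z (seg z))" by (intro card_mono) auto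
    also have "\<dots> \<le> Suc (card (seg z))" by (rule card_insert_le_m1) simp_all
    finally have "card (shadow B) \<le> card (seg z)" using less by simp
    then have "card B \<le> card (seg (add_mset 0 z))" using macaulay[of z] u \<open>u \<noteq> {#}\<close> by simp
    also have "\<dots> < card (seg u)" using u False by (intro card_seg_less) auto
    finally show False using B(4) by simp
  qed
qed

text \<open>The outer induction is on the number of variables, the inner one on the degree. For a
  stable set the members containing 0 are counted by the shadow; those avoiding 0 become, after
  lowering, a set in fewer variables whose shadow is controlled by Green's bound.\<close>

theorem macaulay_bound:
  fixes A :: "nat multiset set"
  assumes "A \<subseteq> multisets_of_size {..<b} (Suc (size u))" "card (shadow A) \<le> card (seg u)"
  shows "card A \<le> card (seg (add_mset 0 u))"
  using assms
proof (induction b arbitrary: A u)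
  case 0
  then have "A = {}" by (auto simp: multisets_of_size_def)
  then show ?case by simp
next
  case (Suc b)
  note outer_IH = Suc.IH
  from Suc.prems show ?case
  proof (induction "size u" arbitrary: A u rule: less_induct)
    case less
    obtain A' where A': "A' \<subseteq> multisets_of_size {..<Suc b} (Suc (size u))" "card A' = card A"
      "card (shadow A') \<le> card (shadow A)" "zero_stable A'"
      using ex_zero_stable[OF less.prems(1)] by blast
    have fin: "finite A'" using A'(1) by (auto intro: finite_subset[OF _ finite_multisets_of_size])
    define B where "B = shadow A'"
    have B: "B = {w. add_mset 0 w \<in> A'}" unfolding B_def using A' by (intro shadow_zero_stable)
    have Bsub: "B \<subseteq> multisets_of_size {..<Suc b} (size u)" 
    proof
      fix w assume "w \<in> B"
      then have "add_mset 0 w \<in> multisets_of_size {..<Suc b} (Suc (size u))" using A'(1) B by blast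
      then show "w \<in> multisets_of_size {..<Suc b} (size u)" by (simp add: multisets_of_size_def)
    qed
    have Bstab: "zero_stable B" unfolding B_def using A'(4) by (rule zero_stable_shadow)
    have "card B \<le> card (seg u)" using A'(3) less.prems(2) by (simp add: B_def)
    \<comment> \<open>Green's bound compares sets of equal cardinality, so \<open>u\<close> is
      lowered to the multiset whose rank is exactly \<open>card B\<close>.\<close>
    then obtain u' where u': "size u' = size u" "u' \<le> u" "card (seg u') = card B"
    proof (cases "card B = card (seg u)")
      case False
      then have "card B < card (seg u)" using \<open>card B \<le> card (seg u)\<close> by simp
      then show ?thesis by (rule ex_card_seg_less) (use that in \<open>auto intro: less_imp_le\<close>)
    qed auto
    have green: "card {w \<in> B. 0 \<notin># w} \<le> card {w \<in> seg u'. 0 \<notin># w}"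
    proof (rule card_without_zero_le[OF Bstab])
      show "card B \<le> card (seg (add_mset 0 z))"
        if "size u' = Suc (size z)" "card (shadow B) \<le> card (seg z)" for z
        using less.hyps[of z B] that u' Bsub by simp
    qed (use Bsub u' in auto)
    obtain w where w: "size w = size u'" "{v \<in> seg u'. 0 \<notin># v} = image_mset Suc ` seg w"
      by (rule ex_seg_without_zero)
    have inj: "inj_on (image_mset Suc) Y" for Y
      by (rule inj_on_subset[OF multiset.inj_map]) auto
    define A0 where "A0 = {w. image_mset Suc w \<in> A'}"
    have A0: "{w \<in> A'. 0 \<notin># w} = image_mset Suc ` A0"
      by (auto simp: A0_def image_iff) (metis image_mset_Suc_surj)
    \<comment> \<open>Dropping an entry from a zero-free member of \<open>A'\<close> gives a
      zero-free member of \<open>B\<close>, so Green's bound supplies the hypothesis for the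
      induction on variables.\<close>
    have "image_mset Suc ` shadow A0 \<subseteq> {w \<in> B. 0 \<notin># w}"
      by (auto simp: B_def shadow_def A0_def)
    then have "card (image_mset Suc ` shadow A0) \<le> card {w \<in> B. 0 \<notin># w}"
      by (rule card_mono[rotated]) (use fin in \<open>simp add: B_def finite_shadow\<close>)
    also have "\<dots> \<le> card (image_mset Suc ` seg w)" using green w by simp
    finally have "card (shadow A0) \<le> card (seg w)" by (simp add: card_image inj)
    moreover have "A0 \<subseteq> multisets_of_size {..<b} (Suc (size w))"
    proof
      fix v assume "v \<in> A0"
      then have "image_mset Suc v \<in> multisets_of_size {..<Suc b} (Suc (size u))"
        using A'(1) by (auto simp: A0_def)
      then show "v \<in> multisets_of_size {..<b} (Suc (size w))"
        using w u' by (auto simp: multisets_of_size_def)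
    qed
    ultimately have "card A0 \<le> card (seg (add_mset 0 w))" by (intro outer_IH)
    then have "card {w \<in> A'. 0 \<notin># w} \<le> card (image_mset Suc ` seg (add_mset 0 w))"
      unfolding A0 by (simp add: card_image inj)
    also have "\<dots> \<le> card {v \<in> seg (add_mset 0 u'). 0 \<notin># v}"
      using seg_without_zero_add_zero[OF w] by (intro card_mono) auto
    finally have "card A' \<le> card (seg (add_mset 0 u'))"
      using card_zero_split[OF fin] card_zero_split[OF finite_seg, of "add_mset 0 u'"] u' 
      by (simp add: B seg_add_zero)
    also have "\<dots> \<le> card (seg (add_mset 0 u))" using u' by (intro card_seg_mono) auto
    finally show ?case using A' by simp
  qed
qed

section \<open>The binomial operator, labelled sets and order ideals\<close>

lemma card_le_binomial_shift:
  fixes A :: "nat multiset set"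
  assumes "finite A" "\<And>u. u \<in> A \<Longrightarrow> size u = Suc d" "card (shadow A) \<le> n" "d \<ge> 1"
  shows "card A \<le> binomial_shift n d"
proof -
  have "finite (\<Union>u\<in>A. set_mset u)" using assms(1) by simp
  then obtain b where "(\<Union>u\<in>A. set_mset u) \<subseteq> {..<b}" by (meson finite_nat_iff_bounded)
  then have A: "A \<subseteq> multisets_of_size {..<b} (Suc d)" using assms(2) by (auto simp: multisets_of_size_def)
  obtain u where u: "size u = d" "card (seg u) = n" using ex_card_seg[OF assms(4)] by blast
  then have "card A \<le> card (seg (add_mset 0 u))" using A assms(3) by (intro macaulay_bound) auto
  then show ?thesis using binomial_shift_card_seg[of u] u by simp
qed

text \<open>A set of pairs is encoded by spending the second component on the largest element and
  giving all other elements the second component \<open>t\<close>.\<close>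

lemma card_labelled_le_binomial_shift:
  fixes St :: "nat multiset \<Rightarrow> nat \<Rightarrow> bool"
  assumes fin: "\<And>n. finite {(u, i). size u = n \<and> St u i}"
    and down: "\<And>j u i. St (add_mset j u) i \<Longrightarrow> St u i" "\<And>j u i. St (add_mset j u) i \<Longrightarrow> St u t"
    and d: "d \<ge> 1"
  shows "card {(u, i). size u = Suc d \<and> St u i} \<le> binomial_shift (card {(u, i). size u = d \<and> St u i}) d"
proof -
  let ?Std = "\<lambda>n. {(u, i). size u = n \<and> St u i}"
  \<comment> \<open>Pairs are coded as natural numbers because the bound concerns multisets of
    naturals. The first components still recover \<open>u\<close>, and the maximum singles out the
    entry that carries the label.\<close>
  let ?f = "\<lambda>j. prod_encode (j, t)"
  define code where "code = (\<lambda>(u, i). add_mset (prod_encode (Max_mset u, i)) (image_mset ?f (u - {#Max_mset u#})))"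
  have code: "code (add_mset m w, i) = add_mset (prod_encode (m, i)) (image_mset ?f w)"
    if "\<And>y. y \<in># w \<Longrightarrow> y \<le> m" for m w i
  proof -
    have "Max_mset (add_mset m w) = m" using that by (intro Max_eqI) auto
    then show ?thesis by (simp add: code_def)
  qed
  have max: "\<exists>m w. u = add_mset m w \<and> (\<forall>y. y \<in># w \<longrightarrow> y \<le> m)" if "u \<noteq> {#}" for u :: "nat multiset"
  proof -
    have "Max_mset u \<in># u" using that by simp
    then have "u = add_mset (Max_mset u) (u - {#Max_mset u#})" by simp
    moreover have "y \<le> Max_mset u" if "y \<in># u - {#Max_mset u#}" for y using that by (auto dest: in_diffD)
    ultimately show ?thesis by blast
  qed
  have inj: "inj_on code (?Std n)" if "n \<ge> 1" for n
  proof (rule inj_onI)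
    fix x y assume "x \<in> ?Std n" "y \<in> ?Std n" and eq: "code x = code y"
    then obtain u i v k where x: "x = (u, i)" "size u = n" and y: "y = (v, k)" "size v = n" by auto
    have dec: "image_mset (fst \<circ> prod_decode) (code (u, i)) = u" if "size u = n" for u i
    proof -
      have "u \<noteq> {#}" using that \<open>n \<ge> 1\<close> by auto
      then obtain m w where "u = add_mset m w" "\<And>y. y \<in># w \<Longrightarrow> y \<le> m" using max by blast
      then show ?thesis by (simp add: code multiset.map_comp o_def)
    qed
    have uv: "u = v" using dec[OF x(2), of i] dec[OF y(2), of k] eq x y by simp
    have "u \<noteq> {#}" using x that by auto
    then obtain m w where w: "u = add_mset m w" "\<And>y. y \<in># w \<Longrightarrow> y \<le> m" using max by blast
    have "code (add_mset m w, i) = code (add_mset m w, k)" using eq x y uv w(1) by simp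
    then have "i = k" using w(2) by (simp add: code)
    then show "x = y" using x y uv by simp
  qed
  have size_code: "size (code x) = Suc d" if "x \<in> ?Std (Suc d)" for x
  proof -
    obtain u i where x: "x = (u, i)" "size u = Suc d" using \<open>x \<in> ?Std (Suc d)\<close> by auto
    then have "u \<noteq> {#}" by auto
    then obtain m w where "u = add_mset m w" "\<And>y. y \<in># w \<Longrightarrow> y \<le> m" using max by blast
    then show ?thesis using x by (simp add: code)
  qed
  have "shadow (code ` ?Std (Suc d)) \<subseteq> code ` ?Std d"
  proof
    fix v assume "v \<in> shadow (code ` ?Std (Suc d))"
    then obtain x u i where x: "add_mset x v = code (u, i)" and u: "size u = Suc d" "St u i"
      by (auto simp: shadow_def)
    have "u \<noteq> {#}" using u by auto
    then obtain m w where w: "u = add_mset m w" "\<And>y. y \<in># w \<Longrightarrow> y \<le> m" using max by blast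
    have "add_mset x v = add_mset (prod_encode (m, i)) (image_mset ?f w)" using x w by (simp add: code)
    then consider "v = image_mset ?f w"
      | K where "image_mset ?f w = add_mset x K" "v = add_mset (prod_encode (m, i)) K"
      by (auto simp: add_eq_conv_ex)
    then show "v \<in> code ` ?Std d"
    proof cases
      case 1
      \<comment> \<open>Without its marked entry the code has only labels \<open>t\<close>, so it
        codes \<open>w\<close> with its largest entry marked by \<open>t\<close>. Such an entry
        exists because \<open>d\<close> is positive.\<close>
      have "w \<noteq> {#}" using u(1) w(1) d by auto
      then obtain m' w' where w': "w = add_mset m' w'" "\<And>y. y \<in># w' \<Longrightarrow> y \<le> m'" using max by blast
      have "v = code (w, t)" using 1 w' by (simp add: code)
      moreover have "(w, t) \<in> ?Std d" using u w(1) down(2) by auto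
      ultimately show ?thesis by blast
    next
      case 2
      obtain j w' where w': "w = add_mset j w'" "K = image_mset ?f w'"
        using msed_map_invR[OF 2(1)] by blast
      have "v = code (add_mset m w', i)" using 2(2) w w' by (subst code) auto
      moreover have "(add_mset m w', i) \<in> ?Std d"
        using u w(1) w'(1) down(1)[of j "add_mset m w'" i] by (simp add: add_mset_commute)
      ultimately show ?thesis by blast
    qed
  qed
  then have "card (shadow (code ` ?Std (Suc d))) \<le> card (code ` ?Std d)"
    by (rule card_mono[rotated]) (rule finite_imageI[OF fin])
  also have "\<dots> = card (?Std d)" by (rule card_image[OF inj[OF d]])
  finally have "card (code ` ?Std (Suc d)) \<le> binomial_shift (card (?Std d)) d"
    using size_code d by (intro card_le_binomial_shift) (auto intro: finite_imageI[OF fin])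
  then show ?thesis by (simp add: card_image[OF inj])
qed

text \<open>In each positive degree the initial segment with \<open>H n\<close> members is taken.
  Growth says that its end \<open>w\<close> satisfies
  \<open>w (Suc n) \<le> add_mset 0 (w n)\<close>, so removing a minimum stays inside; removing any
  other entry leaves a multiset at most as large.\<close>

lemma ex_order_ideal:
  assumes H: "\<And>n. n \<ge> 1 \<Longrightarrow> H (n + 1) \<le> binomial_shift (H n) n"
  obtains S where "\<And>u. u \<in> S \<Longrightarrow> set_mset u \<subseteq> {..<H 1}"
    "\<And>u v. u \<in> S \<Longrightarrow> v \<subseteq># u \<Longrightarrow> v \<noteq> {#} \<Longrightarrow> v \<in> S"
    "\<And>n. n \<ge> 1 \<Longrightarrow> card {u \<in> S. size u = n} = H n"
proof -
  have "\<forall>n. \<exists>w. n \<ge> 1 \<longrightarrow> size w = n \<and> card (seg w) = H n" by (meson ex_card_seg)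
  then obtain w where w: "\<And>n. n \<ge> 1 \<Longrightarrow> size (w n) = n" "\<And>n. n \<ge> 1 \<Longrightarrow> card (seg (w n)) = H n" by metis
  \<comment> \<open>The empty multiset is left out, since the value in degree 0 is a length of the
    ring and not a count of monomials.\<close>
  define S where "S = {u. u \<noteq> {#} \<and> u < w (size u)}"
  have seg: "{u \<in> S. size u = n} = seg (w n)" if "n \<ge> 1" for n
    using that w(1)[OF that] by (auto simp: S_def seg_def)
  have le: "w (Suc n) \<le> add_mset 0 (w n)" if "n \<ge> 1" for n
  proof -
    have "H (Suc n) \<le> card (seg (add_mset 0 (w n)))"
      using H[OF that] binomial_shift_card_seg[of "w n"] w that by simp
    then have "\<not> card (seg (add_mset 0 (w n))) < card (seg (w (Suc n)))" using w(2)[of "Suc n"] by simp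
    then show ?thesis using w(1)[of "Suc n"] w(1)[OF that] by (subst (asm) card_seg_less_iff) auto
  qed
  have down: "u \<in> S" if "add_mset j u \<in> S" "u \<noteq> {#}" for j u
  proof -
    have n: "size u \<ge> 1" using that(2) by (simp add: Suc_le_eq nonempty_has_size)
    obtain m v where v: "add_mset j u = add_mset m v" "\<And>y. y \<in># v \<Longrightarrow> m \<le> y"
      by (rule ex_remove_min[of "add_mset j u"]) auto
    have "size (add_mset j u) = size (add_mset m v)" using v(1) by simp
    then have size: "size v = size u" by simp
    have "add_mset m v < w (Suc (size u))" using that(1) v(1) size by (simp add: S_def)
    also have "\<dots> \<le> add_mset 0 (w (size u))" by (rule le[OF n])
    finally have "v < w (size u)" using add_min_less_add_zero_iff[of v "w (size u)" m] v(2) w(1)[OF n] size by simp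
    moreover have "u \<le> v"
    proof (rule ccontr)
      assume "\<not> u \<le> v"
      then have "v < u" by simp
      moreover have "m \<le> j"
      proof -
        have "j \<in># add_mset m v" by (metis union_single_eq_member v(1))
        then show ?thesis using v(2) by auto
      qed
      ultimately have "add_mset m v < add_mset j u" by (metis add_mset_lt_le_lt)
      then show False using v(1) by simp
    qed
    ultimately show ?thesis using that(2) by (simp add: S_def)
  qed
  show thesis
  proof (rule that)
    show sub: "v \<in> S" if "u \<in> S" "v \<subseteq># u" "v \<noteq> {#}" for u v
    proof -
      have "v \<in> S" if "v + z \<in> S" for z using that
      proof (induction z)
        case (add x z)
        then show ?case using down[of x "v + z"] \<open>v \<noteq> {#}\<close> by simp
      qed simp
      then show ?thesis using that by (metis subset_mset.add_diff_inverse)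
    qed
    show "set_mset u \<subseteq> {..<H 1}" if "u \<in> S" for u
    proof
      fix x assume "x \<in># u"
      then have "{#x#} \<in> S" using sub[OF that, of "{#x#}"] by simp
      then have x: "{#x#} < w 1" by (simp add: S_def)
      \<comment> \<open>The singleton of \<open>y\<close> has rank \<open>y\<close>, so degree 1
        uses exactly the variables below \<open>H 1\<close>.\<close>
      obtain y where y: "w 1 = {#y#}" using w(1)[of 1] by (metis One_nat_def order_refl size_1_singleton_mset)
      then have "H 1 = y" using w(2)[of 1] card_seg_add_max[of "{#}" y] by simp
      then show "x \<in> {..<H 1}" using x y by simp
    qed
    show "card {u \<in> S. size u = n} = H n" if "n \<ge> 1" for n using seg[OF that] w(2)[OF that] by simp
  qed
qed

section \<open>Length of filtered modules\<close>

context module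
begin

lemma submodule_criterion:
  assumes "H \<subseteq> carrier M" "\<zero>\<^bsub>M\<^esub> \<in> H"
    and "\<And>x y. x \<in> H \<Longrightarrow> y \<in> H \<Longrightarrow> x \<oplus>\<^bsub>M\<^esub> y \<in> H"
    and "\<And>a x. a \<in> carrier R \<Longrightarrow> x \<in> H \<Longrightarrow> a \<odot>\<^bsub>M\<^esub> x \<in> H"
  shows "submodule H R M"
proof (rule submoduleI)
  fix x assume x: "x \<in> H"
  then have "x \<in> carrier M" using assms(1) by auto
  then have "\<ominus>\<^bsub>M\<^esub> x = (\<ominus> \<one>) \<odot>\<^bsub>M\<^esub> x" by (simp add: smult_l_minus)
  then show "\<ominus>\<^bsub>M\<^esub> x \<in> H" using x assms(4) by simp
qed (use assms in auto)

lemma submodule_zero: "submodule H R M \<Longrightarrow> \<zero>\<^bsub>M\<^esub> \<in> H"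
  using subgroup.one_closed[OF submodule.axioms(1)] by fastforce

lemma submodule_cancel:
  assumes H: "submodule H R M" and "x \<in> carrier M" "y \<in> H" "x \<oplus>\<^bsub>M\<^esub> y \<in> H"
  shows "x \<in> H"
proof -
  have y: "y \<in> carrier M" using assms submoduleE(1)[OF H] by auto
  have "x \<oplus>\<^bsub>M\<^esub> y \<oplus>\<^bsub>M\<^esub> \<ominus>\<^bsub>M\<^esub> y \<in> H" using assms submoduleE(3,5)[OF H] by blast
  moreover have "x \<oplus>\<^bsub>M\<^esub> y \<oplus>\<^bsub>M\<^esub> \<ominus>\<^bsub>M\<^esub> y = x" using assms(2) y by (simp add: M.a_assoc M.r_neg)
  ultimately show ?thesis by simp
qed

lemma submodule_zero_module: "submodule {\<zero>\<^bsub>M\<^esub>} R M"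
  by (rule submodule_criterion) auto

lemma submodule_adjoin:
  assumes H: "submodule H R M" and y: "y \<in> carrier M"
  shows "submodule {x \<oplus>\<^bsub>M\<^esub> r \<odot>\<^bsub>M\<^esub> y | x r. x \<in> H \<and> r \<in> carrier R} R M" (is "submodule ?K R M")
proof (rule submodule_criterion)
  note H' = submoduleE[OF H]
  have c: "x \<in> carrier M" if "x \<in> H" for x using that H'(1) by auto
  show "?K \<subseteq> carrier M" using y c by auto
  show "\<zero>\<^bsub>M\<^esub> \<in> ?K" using submodule_zero[OF H] y by (auto intro!: exI[of _ "\<zero>\<^bsub>M\<^esub>"] exI[of _ \<zero>])
  fix u assume "u \<in> ?K"
  then obtain x r where u: "u = x \<oplus>\<^bsub>M\<^esub> r \<odot>\<^bsub>M\<^esub> y" "x \<in> H" "r \<in> carrier R" by auto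
  {
    fix v assume "v \<in> ?K"
    then obtain x' r' where v: "v = x' \<oplus>\<^bsub>M\<^esub> r' \<odot>\<^bsub>M\<^esub> y" "x' \<in> H" "r' \<in> carrier R" by auto
    have "u \<oplus>\<^bsub>M\<^esub> v = (x \<oplus>\<^bsub>M\<^esub> x') \<oplus>\<^bsub>M\<^esub> (r \<oplus> r') \<odot>\<^bsub>M\<^esub> y"
      using u v y c by (simp add: smult_l_distr M.a_ac)
    then show "u \<oplus>\<^bsub>M\<^esub> v \<in> ?K" using u v H'(5) by blast
  next
    fix a assume a: "a \<in> carrier R"
    have "a \<odot>\<^bsub>M\<^esub> u = a \<odot>\<^bsub>M\<^esub> x \<oplus>\<^bsub>M\<^esub> (a \<otimes> r) \<odot>\<^bsub>M\<^esub> y"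
      using u y c a by (simp add: smult_r_distr smult_assoc1)
    then show "a \<odot>\<^bsub>M\<^esub> u \<in> ?K" using u a H'(4) by blast
  }
qed

definition submodule_chain :: "(nat \<Rightarrow> 'c set) \<Rightarrow> nat \<Rightarrow> bool" where
  "submodule_chain N k \<longleftrightarrow> (\<forall>i\<le>k. submodule (N i) R M) \<and> (\<forall>i<k. N i \<subset> N (Suc i))"

lemma module_length_eq: "module_length R M = Sup {enat k | k. \<exists>N. submodule_chain N k}"
  by (simp add: module_length_def submodule_chain_def)

lemma submodule_chain_le_length: "submodule_chain N k \<Longrightarrow> enat k \<le> module_length R M"
  unfolding module_length_eq by (rule Sup_upper) blast

text \<open>\<open>p\<close> runs from 0, which puts \<open>K\<close> in front, to
  \<open>Suc k\<close>, which puts it behind; one statement covers refinement at both ends and in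
  the middle.\<close>

lemma submodule_chain_insert:
  assumes N: "submodule_chain N k" and K: "submodule K R M" and p: "p \<le> Suc k"
    and lower: "p > 0 \<Longrightarrow> N (p - 1) \<subset> K" and upper: "p \<le> k \<Longrightarrow> K \<subset> N p"
  shows "submodule_chain (\<lambda>i. if i < p then N i else if i = p then K else N (i - 1)) (Suc k)"
  unfolding submodule_chain_def
proof (intro conjI allI impI)
  fix i assume "i \<le> Suc k"
  then show "submodule (if i < p then N i else if i = p then K else N (i - 1)) R M"
    using assms by (auto simp: submodule_chain_def)
next
  fix i assume i: "i < Suc k"
  have N': "j < k \<Longrightarrow> N j \<subset> N (Suc j)" for j using N by (simp add: submodule_chain_def)
  consider "Suc i < p" | "Suc i = p" | "i = p" | "i > p" by linarith
  then show "(if i < p then N i else if i = p then K else N (i - 1))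
      \<subset> (if Suc i < p then N (Suc i) else if Suc i = p then K else N (Suc i - 1))"
  proof cases
    case 1 then show ?thesis using N'[of i] p by simp
  next
    case 2 then show ?thesis using lower by auto
  next
    case 3 then show ?thesis using upper i by simp
  next
    case 4
    then have "N (i - 1) \<subset> N (Suc (i - 1))" using i by (intro N') simp
    then show ?thesis using 4 by simp
  qed
qed

text \<open>The last clause is simplicity of the factors: every \<open>y\<close> outside
  \<open>N i\<close> cancels any \<open>x\<close> modulo \<open>N i\<close> by a multiple. Leading
  terms are cancelled in this form later.\<close>

definition composition_series :: "(nat \<Rightarrow> 'c set) \<Rightarrow> nat \<Rightarrow> bool" where
  "composition_series N k \<longleftrightarrow> submodule_chain N k \<and> N 0 = {\<zero>\<^bsub>M\<^esub>} \<and> N k = carrier M \<and>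
     (\<forall>i<k. \<forall>x\<in>N (Suc i). \<forall>y\<in>N (Suc i) - N i. \<exists>r\<in>carrier R. x \<oplus>\<^bsub>M\<^esub> r \<odot>\<^bsub>M\<^esub> y \<in> N i)"

text \<open>A finite length is attained by some chain, and nothing can be inserted into it. Trying
  the zero module, the whole module, and \<open>N i\<close> enlarged by the multiples of
  \<open>y\<close> gives the three properties.\<close>

lemma ex_composition_series:
  assumes "module_length R M = enat k"
  obtains N where "composition_series N k"
proof -
  let ?S = "{enat k | k. \<exists>N. submodule_chain N k}"
  have "submodule_chain (\<lambda>_. carrier M) 0"
    by (simp add: submodule_chain_def carrier_is_submodule)
  then have ne: "?S \<noteq> {}" by blast
  have Sup: "Sup ?S = enat k" using assms by (simp add: module_length_eq)
  have fin: "finite ?S"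
  proof (rule finite_subset)
    show "?S \<subseteq> enat ` {..k}"
      using submodule_chain_le_length assms by auto
  qed simp
  have "enat k = Max ?S" unfolding Sup[symmetric] Sup_enat_def using ne fin by (simp only: if_False if_True)
  then have "enat k \<in> ?S" using Max_in[OF fin ne] by simp
  then obtain N where N: "submodule_chain N k" by auto
  have maximal: False if "submodule K R M" "p \<le> Suc k" "p > 0 \<Longrightarrow> N (p - 1) \<subset> K" "p \<le> k \<Longrightarrow> K \<subset> N p" for K p
    using submodule_chain_le_length[OF submodule_chain_insert[OF N that]] assms by simp
  have sub: "submodule (N i) R M" if "i \<le> k" for i using N that by (simp add: submodule_chain_def)
  have "composition_series N k"
    unfolding composition_series_def
  proof (intro conjI allI impI ballI)
    show "submodule_chain N k" by (rule N)
    show "N 0 = {\<zero>\<^bsub>M\<^esub>}"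
    proof (rule ccontr)
      assume "N 0 \<noteq> {\<zero>\<^bsub>M\<^esub>}"
      then have "{\<zero>\<^bsub>M\<^esub>} \<subset> N 0" using submodule_zero[OF sub[of 0]] by auto
      then show False using maximal[of "{\<zero>\<^bsub>M\<^esub>}" 0] submodule_zero_module by simp
    qed
    show "N k = carrier M"
    proof (rule ccontr)
      assume "N k \<noteq> carrier M"
      then have "N k \<subset> carrier M" using submoduleE(1)[OF sub[of k]] by auto
      then show False using maximal[of "carrier M" "Suc k"] carrier_is_submodule by simp
    qed
    fix i x y assume i: "i < k" and x: "x \<in> N (Suc i)" and y: "y \<in> N (Suc i) - N i"
    have Ni: "submodule (N i) R M" "submodule (N (Suc i)) R M" using sub i by auto
    note E = submoduleE[OF Ni(1)] and E' = submoduleE[OF Ni(2)]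
    have NN: "N i \<subset> N (Suc i)" using N i by (simp add: submodule_chain_def)
    have yc: "y \<in> carrier M" using y E'(1) by auto
    let ?K = "{x \<oplus>\<^bsub>M\<^esub> r \<odot>\<^bsub>M\<^esub> y | x r. x \<in> N i \<and> r \<in> carrier R}"
    have K: "submodule ?K R M" by (rule submodule_adjoin[OF Ni(1) yc])
    have "N i \<subset> ?K"
    proof
      show "N i \<subseteq> ?K"
      proof
        fix z assume z: "z \<in> N i"
        then have "z = z \<oplus>\<^bsub>M\<^esub> \<zero> \<odot>\<^bsub>M\<^esub> y" using E(1) yc by auto
        then show "z \<in> ?K" using z by blast
      qed
      have "y = \<zero>\<^bsub>M\<^esub> \<oplus>\<^bsub>M\<^esub> \<one> \<odot>\<^bsub>M\<^esub> y" using yc by simp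
      then have "y \<in> ?K" using submodule_zero[OF Ni(1)] by blast
      then show "N i \<noteq> ?K" using y by auto
    qed
    moreover have "?K \<subseteq> N (Suc i)" using NN y E'(4,5) by auto
    ultimately have "?K = N (Suc i)" using maximal[OF K, of "Suc i"] i by auto
    then have "x \<in> ?K" using x by blast
    then obtain z r where zr: "z \<in> N i" "r \<in> carrier R" "x = z \<oplus>\<^bsub>M\<^esub> r \<odot>\<^bsub>M\<^esub> y" by blast
    have "x \<oplus>\<^bsub>M\<^esub> (\<ominus> r) \<odot>\<^bsub>M\<^esub> y = z"
      using zr E(1) yc by (auto simp: smult_l_minus M.a_assoc M.r_neg)
    then show "\<exists>r\<in>carrier R. x \<oplus>\<^bsub>M\<^esub> r \<odot>\<^bsub>M\<^esub> y \<in> N i" using zr by (intro bexI[of _ "\<ominus> r"]) auto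
  qed
  then show ?thesis by (rule that)
qed

text \<open>\<open>G w\<close> and \<open>G' w\<close> play the roles of the elements with leading term at most \<open>w\<close>, respectively
  below \<open>w\<close>. A submodule is determined within a larger one by its set of leading terms.\<close>

lemma module_length_filtration:
  fixes W :: "'w::linorder set"
  assumes "finite W"
    and sub: "\<And>w. w \<in> W \<Longrightarrow> submodule (G w) R M"
    and G': "\<And>w. w \<in> W \<Longrightarrow> G' w \<subseteq> G w" "\<And>w. w \<in> W \<Longrightarrow> \<zero>\<^bsub>M\<^esub> \<in> G' w"
    and mono: "\<And>w w'. w \<in> W \<Longrightarrow> w' \<in> W \<Longrightarrow> w < w' \<Longrightarrow> G w \<subseteq> G' w'"
    and exh: "\<And>x. x \<in> carrier M \<Longrightarrow> x \<noteq> \<zero>\<^bsub>M\<^esub> \<Longrightarrow> \<exists>w\<in>W. x \<in> G w - G' w"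
    and simple: "\<And>w x y. w \<in> W \<Longrightarrow> x \<in> G w \<Longrightarrow> y \<in> G w - G' w \<Longrightarrow>
      \<exists>r\<in>carrier R. x \<oplus>\<^bsub>M\<^esub> r \<odot>\<^bsub>M\<^esub> y \<in> G' w"
  shows "module_length R M = enat (card {w \<in> W. G w \<noteq> G' w})"
proof (rule antisym)
  let ?T = "{w \<in> W. G w \<noteq> G' w}"
  let ?J = "\<lambda>P. {w \<in> W. \<exists>x\<in>P. x \<in> G w - G' w}"
  have finT: "finite ?T" using assms(1) by simp
  have step: "?J P \<subset> ?J P'" if P: "submodule P R M" "submodule P' R M" "P \<subset> P'" for P P'
  proof (rule ccontr)
    assume "\<not> ?J P \<subset> ?J P'"
    moreover have "?J P \<subseteq> ?J P'" using that by blast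
    ultimately have eq: "?J P = ?J P'" by blast
    note E = submoduleE[OF P(1)] and E' = submoduleE[OF P(2)]
    let ?A = "{w \<in> W. \<exists>x\<in>P' - P. x \<in> G w - G' w}"
    have ex: "\<exists>w\<in>?A. x \<in> G w - G' w" if "x \<in> P' - P" for x
    proof -
      have "x \<in> carrier M" "x \<noteq> \<zero>\<^bsub>M\<^esub>" using that E'(1) submodule_zero[OF P(1)] by auto
      then show ?thesis using exh that by blast
    qed
    have ne: "?A \<noteq> {}" using ex P(3) by blast
    have finA: "finite ?A" using assms(1) by simp
    \<comment> \<open>A leading position of \<open>P' - P\<close> is chosen minimal. If
      \<open>P\<close> had an element with the same position, cancelling with it would give another
      element of \<open>P' - P\<close>, lying in \<open>G' w\<close>, against minimality.\<close>
    obtain w where w: "w \<in> ?A" and min: "\<And>w'. w' \<in> ?A \<Longrightarrow> w \<le> w'"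
      by (rule that[OF Min_in[OF finA ne] Min_le[OF finA]])
    then obtain x where x: "x \<in> P'" "x \<notin> P" "x \<in> G w" "x \<notin> G' w" "w \<in> W" by auto
    then have "w \<in> ?J P" using eq by blast
    then obtain y where y: "y \<in> P" "y \<in> G w - G' w" by blast
    then obtain r where r: "r \<in> carrier R" "x \<oplus>\<^bsub>M\<^esub> r \<odot>\<^bsub>M\<^esub> y \<in> G' w" using simple x by blast
    let ?z = "x \<oplus>\<^bsub>M\<^esub> r \<odot>\<^bsub>M\<^esub> y"
    have ry: "r \<odot>\<^bsub>M\<^esub> y \<in> P" using r y E(4) by blast
    have xc: "x \<in> carrier M" using x E'(1) by auto
    have "?z \<in> P'" using x ry P(3) E'(5) by blast
    moreover have "?z \<notin> P" using submodule_cancel[OF P(1) xc ry] x by blast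
    ultimately obtain w' where w': "w' \<in> ?A" "?z \<in> G w' - G' w'" using ex[of ?z] by blast
    then have "w \<le> w'" using min by blast
    moreover have "w' \<in> W" using w' by blast
    ultimately have "G' w \<subseteq> G' w'" 
      using mono[OF x(5), of w'] G'(1)[OF x(5)] by (cases "w = w'") (auto simp: le_less)
    then show False using r w' by blast
  qed
  show "module_length R M \<le> enat (card ?T)"
    unfolding module_length_eq
  proof (rule Sup_least)
    fix l assume "l \<in> {enat k | k. \<exists>N. submodule_chain N k}"
    then obtain k N where l: "l = enat k" and N: "submodule_chain N k" by auto
    have "i \<le> card (?J (N i))" if "i \<le> k" for i
      using that
    proof (induction i)
      case (Suc i)
      have "?J (N i) \<subset> ?J (N (Suc i))" using N Suc.prems by (intro step) (auto simp: submodule_chain_def)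
      then have "card (?J (N i)) < card (?J (N (Suc i)))" using assms(1) by (intro psubset_card_mono) auto
      then show ?case using Suc by simp
    qed simp
    then have "k \<le> card (?J (N k))" by simp
    also have "\<dots> \<le> card ?T" using finT by (intro card_mono) auto
    finally show "l \<le> enat (card ?T)" using l by simp
  qed
  let ?xs = "sorted_list_of_set ?T"
  have len: "length ?xs = card ?T" by simp
  have nth: "?xs ! i \<in> ?T" if "i < card ?T" for i
    using nth_mem[of i ?xs] that finT by simp
  have less: "?xs ! i < ?xs ! Suc i" if "Suc i < card ?T" for i
    using sorted_wrt_nth_less[OF strict_sorted_list_of_set, of i "Suc i"] that by simp
  \<comment> \<open>For the lower bound the filtration itself is a chain once the positions without
    a jump are removed.\<close>
  have "submodule_chain (\<lambda>i. if i = 0 then {\<zero>\<^bsub>M\<^esub>} else G (?xs ! (i - 1))) (card ?T)"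
    unfolding submodule_chain_def
  proof (intro conjI allI impI)
    fix i assume i: "i \<le> card ?T"
    show "submodule (if i = 0 then {\<zero>\<^bsub>M\<^esub>} else G (?xs ! (i - 1))) R M"
      using nth[of "i - 1"] i sub submodule_zero_module by auto
  next
    fix i assume i: "i < card ?T"
    have w: "?xs ! i \<in> ?T" using nth i by blast
    then have G: "G' (?xs ! i) \<subset> G (?xs ! i)" using G'(1) by blast
    have "(if i = 0 then {\<zero>\<^bsub>M\<^esub>} else G (?xs ! (i - 1))) \<subseteq> G' (?xs ! i)"
    proof (cases "i = 0")
      case True
      then show ?thesis using G'(2) w by auto
    next
      case False
      then have "?xs ! (i - 1) < ?xs ! i" "?xs ! (i - 1) \<in> ?T" using less[of "i - 1"] nth[of "i - 1"] i by auto
      then show ?thesis using mono[of "?xs ! (i - 1)" "?xs ! i"] w False by simp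
    qed
    then show "(if i = 0 then {\<zero>\<^bsub>M\<^esub>} else G (?xs ! (i - 1)))
        \<subset> (if Suc i = 0 then {\<zero>\<^bsub>M\<^esub>} else G (?xs ! (Suc i - 1)))"
      using G by auto
  qed
  then show "enat (card ?T) \<le> module_length R M" by (rule submodule_chain_le_length)
qed

end

section \<open>The ring as a module over itself\<close>

context cring
begin

lemma self_module_sel [simp]:
  "carrier (self_module R) = carrier R" "add (self_module R) = add R"
  "ring.zero (self_module R) = \<zero>" "smult (self_module R) = (\<otimes>)"
  by (simp_all add: self_module_def)

lemma self_module_module: "module R (self_module R)"
proof (rule moduleI)
  show "abelian_group (self_module R)"
    by (rule abelian_groupI) (auto simp: a_ac intro: l_neg bexI[of _ "\<ominus> _"])
qed (auto simp: is_cring l_distr r_distr m_assoc)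

lemma submodule_self_module_iff: "submodule N R (self_module R) \<longleftrightarrow> ideal N R"
proof
  interpret S: module R "self_module R" by (rule self_module_module)
  {
    assume N: "submodule N R (self_module R)"
    note E = S.submoduleE[OF N, simplified]
    show "ideal N R"
    proof (rule idealI)
      show "subgroup N (add_monoid R)"
      proof (rule add.subgroupI)
        show "\<ominus> a \<in> N" if "a \<in> N" for a
        proof -
          have "\<ominus> a = (\<ominus> \<one>) \<otimes> a" using that E(1) by (auto simp: l_minus)
          then show ?thesis using E(4)[OF _ that, of "\<ominus> \<one>"] by simp
        qed
      qed (use E in auto)
      show "x \<otimes> a \<in> N" "a \<otimes> x \<in> N" if "a \<in> N" "x \<in> carrier R" for a x
        using E(1) E(4)[OF that(2,1)] that by (auto simp: m_comm subset_iff)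
    qed (rule ring_axioms)
  next
    assume "ideal N R"
    then interpret N: ideal N R .
    show "submodule N R (self_module R)"
      by (rule S.submodule_criterion) (auto simp: N.I_l_closed N.a_closed N.a_subset N.zero_closed)
  }
qed

end

text \<open>Finite length replaces Zorn's lemma: a longest chain of ideals whose last member is
  proper and contains \<open>N\<close> ends in a maximal ideal, since otherwise a larger proper
  ideal could be appended.\<close>

lemma (in local_ring) proper_ideal_le:
  assumes "module_length R (self_module R) = enat e" "ideal N R" "N \<noteq> carrier R"
  shows "N \<subseteq> \<mm>"
proof -
  interpret S: module R "self_module R" by (rule self_module_module)
  let ?P = "\<lambda>k. \<exists>C. S.submodule_chain C k \<and> N \<subseteq> C k \<and> C k \<noteq> carrier R"
  have "S.submodule_chain (\<lambda>_. N) 0"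
    using assms(2) by (simp add: S.submodule_chain_def submodule_self_module_iff)
  then have "?P 0" using assms(3) by auto
  moreover have "k \<le> e" if "?P k" for k
    using that S.submodule_chain_le_length assms(1) by force
  ultimately obtain k where k: "?P k" "\<And>l. ?P l \<Longrightarrow> l \<le> k"
    using GreatestI_nat[of ?P 0 e] Greatest_le_nat[of ?P _ e] by blast
  then obtain C where C: "S.submodule_chain C k" "N \<subseteq> C k" "C k \<noteq> carrier R" by blast
  have "maximalideal (C k) R"
  proof (rule maximalidealI)
    show "ideal (C k) R" using C(1) by (auto simp: S.submodule_chain_def submodule_self_module_iff)
    show "carrier R \<noteq> C k" using C by auto
    fix J assume J: "ideal J R" "C k \<subseteq> J" "J \<subseteq> carrier R"
    show "J = C k \<or> J = carrier R"
    proof (rule ccontr)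
      assume neq: "\<not> (J = C k \<or> J = carrier R)"
      let ?C = "\<lambda>i. if i < Suc k then C i else if i = Suc k then J else C (i - 1)"
      have "S.submodule_chain ?C (Suc k)"
        using J neq by (intro S.submodule_chain_insert[OF C(1)]) (auto simp: submodule_self_module_iff)
      then have "?P (Suc k)" using J neq C by (intro exI[of _ ?C]) auto
      then show False using k(2)[of "Suc k"] by simp
    qed
  qed
  then show ?thesis using C(2) maximalideal_unique by blast
qed

section \<open>Leading coefficient ideals\<close>

context cring
begin

lemma mpoly_ring_sel:
  "add (mpoly_ring R b) p q = (\<lambda>u. p u \<oplus> q u)"
  "\<zero>\<^bsub>mpoly_ring R b\<^esub> = (\<lambda>u. \<zero>)"
  "p \<otimes>\<^bsub>mpoly_ring R b\<^esub> q = (\<lambda>u. \<Oplus>v\<in>{v. v \<subseteq># u}. p v \<otimes> q (u - v))"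
  by (simp_all add: mpoly_ring_def)

lemma mpoly_coeff_closed: "p \<in> carrier (mpoly_ring R b) \<Longrightarrow> p u \<in> carrier R"
  by (auto simp: mpoly_ring_def)

lemma mpoly_grade_subset: "mpoly_grade R b n \<subseteq> carrier (mpoly_ring R b)"
  by (auto simp: mpoly_grade_def)

lemma mpoly_grade_coeff_closed: "p \<in> mpoly_grade R b n \<Longrightarrow> p u \<in> carrier R"
  by (auto simp: mpoly_grade_def mpoly_coeff_closed)

lemma mpoly_gradeI:
  assumes "\<And>u. p u \<in> carrier R" "\<And>u. p u \<noteq> \<zero> \<Longrightarrow> size u = n \<and> set_mset u \<subseteq> {..<b}"
  shows "p \<in> mpoly_grade R b n"
proof -
  have "{u. p u \<noteq> \<zero>} \<subseteq> multisets_of_size {..<b} n" using assms(2) by (auto simp: multisets_of_size_def)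
  then have "finite {u. p u \<noteq> \<zero>}" by (rule finite_subset) (simp add: finite_multisets_of_size)
  then show ?thesis using assms by (auto simp: mpoly_grade_def mpoly_ring_def)
qed

lemma mpoly_gradeD: "p \<in> mpoly_grade R b n \<Longrightarrow> p u \<noteq> \<zero> \<Longrightarrow> size u = n \<and> set_mset u \<subseteq> {..<b}"
  by (auto simp: mpoly_grade_def mpoly_ring_def)

lemma mpoly_grade_add:
  assumes "p \<in> mpoly_grade R b n" "q \<in> mpoly_grade R b n"
  shows "(\<lambda>u. p u \<oplus> q u) \<in> mpoly_grade R b n"
proof (rule mpoly_gradeI)
  fix u assume "p u \<oplus> q u \<noteq> \<zero>"
  then have "p u \<noteq> \<zero> \<or> q u \<noteq> \<zero>" by auto
  then show "size u = n \<and> set_mset u \<subseteq> {..<b}" using assms mpoly_gradeD by blast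
qed (use assms mpoly_grade_coeff_closed in auto)

lemma mpoly_grade_scale:
  assumes "p \<in> mpoly_grade R b n" "a \<in> carrier R"
  shows "(\<lambda>u. a \<otimes> p u) \<in> mpoly_grade R b n"
proof (rule mpoly_gradeI)
  fix u assume "a \<otimes> p u \<noteq> \<zero>"
  then have "p u \<noteq> \<zero>" using assms(2) by auto
  then show "size u = n \<and> set_mset u \<subseteq> {..<b}" using assms(1) mpoly_gradeD by blast
qed (use assms mpoly_grade_coeff_closed in auto)

lemma mpoly_grade_zero: "(\<lambda>u. \<zero>) \<in> mpoly_grade R b n"
  by (rule mpoly_gradeI) auto

lemma mpoly_const_closed: "a \<in> carrier R \<Longrightarrow> mpoly_const R a \<in> carrier (mpoly_ring R b)"
  by (auto simp: mpoly_const_def mpoly_ring_def)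

lemma mpoly_const_mult:
  assumes "a \<in> carrier R" "p \<in> carrier (mpoly_ring R b)"
  shows "mpoly_const R a \<otimes>\<^bsub>mpoly_ring R b\<^esub> p = (\<lambda>u. a \<otimes> p u)"
proof
  fix u
  have "(\<Oplus>v\<in>{v. v \<subseteq># u}. mpoly_const R a v \<otimes> p (u - v)) = (\<Oplus>v\<in>{v. v \<subseteq># u}. if {#} = v then a \<otimes> p u else \<zero>)"
    using assms by (intro finsum_cong') (auto simp: mpoly_const_def mpoly_coeff_closed)
  also have "\<dots> = a \<otimes> p u"
    using finsum_singleton[of "{#}" "{v. v \<subseteq># u}" "\<lambda>v. a \<otimes> p u"] assms
    by (simp add: finite_submultisets Pi_def mpoly_coeff_closed)
  finally show "(mpoly_const R a \<otimes>\<^bsub>mpoly_ring R b\<^esub> p) u = a \<otimes> p u" by (simp add: mpoly_ring_sel)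
qed

definition monomial :: "'a \<Rightarrow> nat multiset \<Rightarrow> nat multiset \<Rightarrow> 'a" where
  "monomial c u = (\<lambda>v. if v = u then c else \<zero>)"

lemma monomial_same [simp]: "monomial c u u = c"
  by (simp add: monomial_def)

lemma monomial_grade:
  "c \<in> carrier R \<Longrightarrow> set_mset u \<subseteq> {..<b} \<Longrightarrow> monomial c u \<in> mpoly_grade R b (size u)"
  by (rule mpoly_gradeI) (auto simp: monomial_def split: if_splits)

lemma monomial_mult:
  assumes "p \<in> carrier (mpoly_ring R b)"
  shows "(monomial \<one> w \<otimes>\<^bsub>mpoly_ring R b\<^esub> p) u = (if w \<subseteq># u then p (u - w) else \<zero>)"
proof -
  have "(\<Oplus>v\<in>{v. v \<subseteq># u}. monomial \<one> w v \<otimes> p (u - v)) = (\<Oplus>v\<in>{v. v \<subseteq># u}. if w = v then p (u - v) else \<zero>)"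
    using assms by (intro finsum_cong') (auto simp: monomial_def mpoly_coeff_closed)
  also have "\<dots> = (if w \<subseteq># u then p (u - w) else \<zero>)"
  proof (cases "w \<subseteq># u")
    case True
    then show ?thesis
      using finsum_singleton[of w "{v. v \<subseteq># u}" "\<lambda>v. p (u - v)"] assms
      by (simp add: finite_submultisets Pi_def mpoly_coeff_closed)
  next
    case False
    then show ?thesis by (intro trans[OF add.finprod_one_eqI]) auto
  qed
  finally show ?thesis by (simp add: mpoly_ring_sel)
qed

end

section \<open>Graded pieces of a quotient by a homogeneous ideal\<close>

locale homogeneous_quotient = cring R for R (structure) +
  fixes b :: nat and I :: "(nat multiset \<Rightarrow> 'a) set"
  assumes homogeneous: "homogeneous_ideal R b I"
begin

abbreviation "P \<equiv> mpoly_ring R b"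

abbreviation residue :: "(nat multiset \<Rightarrow> 'a) \<Rightarrow> (nat multiset \<Rightarrow> 'a) set" where
  "residue p \<equiv> I +>\<^bsub>P\<^esub> p"

abbreviation "piece n \<equiv> (graded_quotient R b I)\<lparr>carrier := grade (graded_quotient R b I) n\<rparr>"

sublocale P: cring P
  by (rule mpoly_ring_cring)

sublocale I: ideal I P
  using homogeneous by (simp add: homogeneous_ideal_def)

sublocale A: algebra R "graded_quotient R b I"
  by (rule graded_quotient_algebra[OF homogeneous])

lemma graded_quotient_sel:
  "carrier (graded_quotient R b I) = carrier (P Quot I)"
  "add (graded_quotient R b I) = add (P Quot I)"
  "\<zero>\<^bsub>graded_quotient R b I\<^esub> = \<zero>\<^bsub>P Quot I\<^esub>"
  "smult (graded_quotient R b I) a x = residue (mpoly_const R a) \<otimes>\<^bsub>P Quot I\<^esub> x"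
  "grade (graded_quotient R b I) n = residue ` mpoly_grade R b n"
  by (simp_all add: graded_quotient_def Let_def)

lemma residue_add:
  assumes "p \<in> carrier P" "q \<in> carrier P"
  shows "residue p \<oplus>\<^bsub>graded_quotient R b I\<^esub> residue q = residue (\<lambda>u. p u \<oplus> q u)"
  unfolding graded_quotient_sel using ring_hom_add[OF I.rcos_ring_hom assms] by (simp add: mpoly_ring_sel)

lemma residue_smult:
  assumes "a \<in> carrier R" "p \<in> carrier P"
  shows "a \<odot>\<^bsub>graded_quotient R b I\<^esub> residue p = residue (\<lambda>u. a \<otimes> p u)"
  unfolding graded_quotient_sel
  using ring_hom_mult[OF I.rcos_ring_hom mpoly_const_closed[OF assms(1)] assms(2)]
  by (simp add: mpoly_const_mult[OF assms])

lemma residue_zero: "\<zero>\<^bsub>graded_quotient R b I\<^esub> = residue (\<lambda>u. \<zero>)"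
proof -
  have "residue \<zero>\<^bsub>P\<^esub> = I" by (rule I.a_rcos_const[OF I.zero_closed])
  then show ?thesis by (simp add: graded_quotient_sel FactRing_def mpoly_ring_sel)
qed

lemma mpoly_minus:
  assumes "p \<in> carrier P" "q \<in> carrier P"
  shows "p \<ominus>\<^bsub>P\<^esub> q = (\<lambda>u. p u \<ominus> q u)"
proof -
  have "(\<lambda>u. \<ominus> \<one> \<otimes> q u) \<in> carrier P"
    using P.m_closed[OF mpoly_const_closed[of "\<ominus> \<one>"] assms(2)] mpoly_const_mult[of "\<ominus> \<one>" q b] assms(2) by simp
  moreover have "(\<lambda>u. \<ominus> \<one> \<otimes> q u) = (\<lambda>u. \<ominus> q u)"
    using assms(2) by (auto simp: l_minus mpoly_coeff_closed)
  ultimately have "\<ominus>\<^bsub>P\<^esub> q = (\<lambda>u. \<ominus> q u)"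
    using assms(2) by (intro P.minus_equality) (auto simp: mpoly_ring_sel mpoly_coeff_closed l_neg)
  then show ?thesis by (simp add: a_minus_def mpoly_ring_sel)
qed

lemma residue_eq_iff:
  assumes "p \<in> carrier P" "q \<in> carrier P"
  shows "residue p = residue q \<longleftrightarrow> (\<lambda>u. p u \<ominus> q u) \<in> I"
  using P.quotient_eq_iff_same_a_r_cos[OF I.is_ideal assms] by (simp add: mpoly_minus[OF assms])

lemma piece_carrier: "carrier (piece n) = residue ` mpoly_grade R b n"
  by (simp add: graded_quotient_sel)

lemma piece_module: "module R (piece n)"
proof -
  have "submodule (grade (graded_quotient R b I) n) R (graded_quotient R b I)"
  proof (rule A.submodule_criterion)
    show "grade (graded_quotient R b I) n \<subseteq> carrier (graded_quotient R b I)"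
      using mpoly_grade_subset[of b n] ring_hom_closed[OF I.rcos_ring_hom] by (auto simp: graded_quotient_sel)
    show "\<zero>\<^bsub>graded_quotient R b I\<^esub> \<in> grade (graded_quotient R b I) n"
      unfolding residue_zero graded_quotient_sel(5) by (rule imageI[OF mpoly_grade_zero])
    fix x assume "x \<in> grade (graded_quotient R b I) n"
    then obtain p where p: "x = residue p" "p \<in> mpoly_grade R b n" by (auto simp: graded_quotient_sel)
    then have pc: "p \<in> carrier P" using mpoly_grade_subset by blast
    show "a \<odot>\<^bsub>graded_quotient R b I\<^esub> x \<in> grade (graded_quotient R b I) n" if "a \<in> carrier R" for a
      unfolding p(1) residue_smult[OF that pc] graded_quotient_sel(5) by (rule imageI[OF mpoly_grade_scale[OF p(2) that]])
    fix y assume "y \<in> grade (graded_quotient R b I) n"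
    then obtain q where q: "y = residue q" "q \<in> mpoly_grade R b n" by (auto simp: graded_quotient_sel)
    then have qc: "q \<in> carrier P" using mpoly_grade_subset by blast
    show "x \<oplus>\<^bsub>graded_quotient R b I\<^esub> y \<in> grade (graded_quotient R b I) n"
      unfolding p(1) q(1) residue_add[OF pc qc] graded_quotient_sel(5) by (rule imageI[OF mpoly_grade_add[OF p(2) q(2)]])
  qed
  then show ?thesis by (rule submodule.submodule_is_module) (rule A.module)
qed

text \<open>With \<open>N\<close> running through a composition series of the ring, the residues of
  these sets refine the filtration by leading monomials to one whose factors are simple or
  zero.\<close>

definition bounded :: "nat multiset \<Rightarrow> 'a set \<Rightarrow> (nat multiset \<Rightarrow> 'a) set" where
  "bounded u N = {p \<in> mpoly_grade R b (size u). (\<forall>v>u. p v = \<zero>) \<and> p u \<in> N}"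

text \<open>The coefficient at \<open>u\<close> may vanish here, which makes this an ideal rather
  than the set of true leading coefficients.\<close>

definition lead :: "nat multiset \<Rightarrow> 'a set" where
  "lead u = (\<lambda>p. p u) ` (I \<inter> bounded u (carrier R))"

lemma bounded_grade: "p \<in> bounded u N \<Longrightarrow> p \<in> mpoly_grade R b (size u)"
  by (simp add: bounded_def)

lemma bounded_closed: "p \<in> bounded u N \<Longrightarrow> p \<in> carrier P"
  using mpoly_grade_subset by (auto simp: bounded_def)

lemma bounded_mono: "N \<subseteq> N' \<Longrightarrow> bounded u N \<subseteq> bounded u N'"
  by (auto simp: bounded_def)

lemma bounded_zero: "\<zero> \<in> N \<Longrightarrow> (\<lambda>u. \<zero>) \<in> bounded u N"
  by (simp add: bounded_def mpoly_grade_zero)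

lemma bounded_add:
  "ideal N R \<Longrightarrow> p \<in> bounded u N \<Longrightarrow> q \<in> bounded u N \<Longrightarrow> (\<lambda>v. p v \<oplus> q v) \<in> bounded u N"
  by (auto simp: bounded_def mpoly_grade_add additive_subgroup.a_closed[OF ideal.axioms(1)])

lemma bounded_scale:
  "ideal N R \<Longrightarrow> p \<in> bounded u N \<Longrightarrow> a \<in> carrier R \<Longrightarrow> (\<lambda>v. a \<otimes> p v) \<in> bounded u N"
  by (auto simp: bounded_def mpoly_grade_scale ideal.I_l_closed)

lemma bounded_monomial: 
  "set_mset u \<subseteq> {..<b} \<Longrightarrow> c \<in> N \<Longrightarrow> c \<in> carrier R \<Longrightarrow> monomial c u \<in> bounded u N"
  by (auto simp: bounded_def monomial_grade) (auto simp: monomial_def)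

lemma bounded_less:
  assumes "size v = size u" "v < u" "\<zero> \<in> N"
  shows "bounded v N' \<subseteq> bounded u N"
  using assms by (auto simp: bounded_def)

lemma residue_bounded_submodule:
  assumes N: "ideal N R"
  shows "submodule (residue ` bounded u N) R (piece (size u))"
proof -
  interpret M: module R "piece (size u)" by (rule piece_module)
  show ?thesis
  proof (rule M.submodule_criterion)
    show "residue ` bounded u N \<subseteq> carrier (piece (size u))"
      unfolding piece_carrier by (auto dest: bounded_grade)
    show "\<zero>\<^bsub>piece (size u)\<^esub> \<in> residue ` bounded u N"
      using residue_zero bounded_zero[OF additive_subgroup.zero_closed[OF ideal.axioms(1)[OF N]]] by simp
    fix x assume "x \<in> residue ` bounded u N"
    then obtain p where p: "x = residue p" "p \<in> bounded u N" by auto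
    show "a \<odot>\<^bsub>piece (size u)\<^esub> x \<in> residue ` bounded u N" if "a \<in> carrier R" for a
      using residue_smult[OF that bounded_closed[OF p(2)]] bounded_scale[OF N p(2) that] p(1) by simp
    fix y assume "y \<in> residue ` bounded u N"
    then obtain q where q: "y = residue q" "q \<in> bounded u N" by auto
    show "x \<oplus>\<^bsub>piece (size u)\<^esub> y \<in> residue ` bounded u N"
      using residue_add[OF bounded_closed[OF p(2)] bounded_closed[OF q(2)]] bounded_add[OF N p(2) q(2)] p(1) q(1)
      by simp
  qed
qed

text \<open>The right side says that \<open>N\<close> is not contained in \<open>N'\<close> plus
  \<open>lead u\<close>. Subtracting an element of \<open>I\<close> with suitable coefficient at
  \<open>u\<close> moves \<open>p\<close> into \<open>bounded u N'\<close> without changing its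
  residue; conversely, equal residues of a monomial and an element of \<open>bounded u N'\<close>
  put their difference into \<open>I\<close>.\<close>

lemma residue_bounded_neq_iff:
  assumes N: "ideal N R" and N': "ideal N' R" "N' \<subseteq> N" and u: "set_mset u \<subseteq> {..<b}"
  shows "residue ` bounded u N \<noteq> residue ` bounded u N' \<longleftrightarrow> (\<exists>c\<in>N. \<forall>d\<in>N'. c \<oplus> d \<notin> lead u)"
proof
  interpret N: ideal N R by (rule N)
  interpret N': ideal N' R by (rule N')
  assume "residue ` bounded u N \<noteq> residue ` bounded u N'"
  then obtain p where p: "p \<in> bounded u N" "residue p \<notin> residue ` bounded u N'"
    using bounded_mono[OF N'(2)] by blast
  have "p u \<oplus> d \<notin> lead u" if d: "d \<in> N'" for d
  proof
    assume "p u \<oplus> d \<in> lead u"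
    then obtain a where a: "a \<in> I" "a \<in> bounded u (carrier R)" "p u \<oplus> d = a u" by (auto simp: lead_def)
    let ?q = "\<lambda>v. p v \<oplus> (\<ominus> \<one>) \<otimes> a v"
    have pc: "p v \<in> carrier R" and ac: "a v \<in> carrier R" for v
      using bounded_closed[OF p(1)] bounded_closed[OF a(2)] mpoly_coeff_closed by blast+
    have dc: "d \<in> carrier R" using d by (rule N'.a_Hcarr)
    have "p u = a u \<oplus> \<ominus> d" using a(3)[symmetric] pc dc by (simp add: a_assoc r_neg)
    then have "?q u = \<ominus> d" using pc[of u] ac[of u] dc by (simp add: l_minus) (metis a_comm a_inv_closed r_neg2 minus_minus a_assoc r_neg l_zero)
    then have "?q u \<in> N'" using d by (simp add: N'.a_inv_closed)
    moreover have "?q \<in> bounded u (carrier R)"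
      using p(1) a(2) bounded_mono[of N "carrier R" u] N.a_subset
      by (intro bounded_add bounded_scale oneideal) auto
    ultimately have q: "?q \<in> bounded u N'" by (simp add: bounded_def)
    have "(\<lambda>v. p v \<ominus> ?q v) = a"
    proof
      fix v show "p v \<ominus> ?q v = a v"
        using pc[of v] ac[of v] by (simp add: l_minus a_minus_def minus_add a_assoc[symmetric] r_neg)
    qed
    then have "residue p = residue ?q"
      using residue_eq_iff[OF bounded_closed[OF p(1)] bounded_closed[OF q]] a(1) by simp
    then show False using p(2) q by blast
  qed
  then show "\<exists>c\<in>N. \<forall>d\<in>N'. c \<oplus> d \<notin> lead u" using p(1) by (auto simp: bounded_def)
next
  interpret N: ideal N R by (rule N)
  interpret N': ideal N' R by (rule N')
  assume "\<exists>c\<in>N. \<forall>d\<in>N'. c \<oplus> d \<notin> lead u"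
  then obtain c where c: "c \<in> N" "\<And>d. d \<in> N' \<Longrightarrow> c \<oplus> d \<notin> lead u" by blast
  have cc: "c \<in> carrier R" using c(1) by (rule N.a_Hcarr)
  have mc: "monomial c u \<in> bounded u N" by (rule bounded_monomial[OF u c(1) cc])
  have "residue (monomial c u) \<notin> residue ` bounded u N'"
  proof
    assume "residue (monomial c u) \<in> residue ` bounded u N'"
    then obtain q where q: "q \<in> bounded u N'" "residue (monomial c u) = residue q" by auto
    let ?a = "\<lambda>v. monomial c u v \<oplus> (\<ominus> \<one>) \<otimes> q v"
    have qc: "q v \<in> carrier R" for v using bounded_closed[OF q(1)] mpoly_coeff_closed by blast
    have "?a = (\<lambda>v. monomial c u v \<ominus> q v)" using qc by (simp add: l_minus a_minus_def)
    then have "?a \<in> I" using residue_eq_iff[OF bounded_closed[OF mc] bounded_closed[OF q(1)]] q(2) by simp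
    moreover have "?a \<in> bounded u (carrier R)"
      using mc q(1) bounded_mono[of N "carrier R" u] bounded_mono[of N' "carrier R" u] N.a_subset N'.a_subset
      by (intro bounded_add bounded_scale oneideal) auto
    ultimately have "?a u \<in> lead u" unfolding lead_def by (intro image_eqI[of _ _ ?a]) simp_all
    moreover have "?a u = c \<oplus> \<ominus> q u" using qc by (simp add: l_minus)
    moreover have "\<ominus> q u \<in> N'" using q(1) by (auto simp: bounded_def N'.a_inv_closed)
    ultimately show False using c(2) by metis
  qed
  then show "residue ` bounded u N \<noteq> residue ` bounded u N'" using mc by blast
qed

lemma lead_ideal: "ideal (lead u) R"
proof -
  interpret S: module R "self_module R" by (rule self_module_module)
  have "submodule (lead u) R (self_module R)"
  proof (rule S.submodule_criterion; simp)
    show "lead u \<subseteq> carrier R" by (auto simp: lead_def bounded_def)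
    show "\<zero> \<in> lead u"
      unfolding lead_def
      by (rule image_eqI[of _ _ "\<lambda>u. \<zero>"]) (use I.zero_closed bounded_zero in \<open>auto simp: mpoly_ring_sel\<close>)
    fix x assume "x \<in> lead u"
    then obtain p where p: "x = p u" "p \<in> I" "p \<in> bounded u (carrier R)" by (auto simp: lead_def)
    show "a \<otimes> x \<in> lead u" if a: "a \<in> carrier R" for a
    proof -
      have "(\<lambda>v. a \<otimes> p v) \<in> I"
        using I.I_l_closed[OF p(2) mpoly_const_closed[OF a]] mpoly_const_mult[OF a bounded_closed[OF p(3)]] by simp
      then show ?thesis using bounded_scale[OF oneideal p(3) a] p(1) by (auto simp: lead_def)
    qed
    fix y assume "y \<in> lead u"
    then obtain q where q: "y = q u" "q \<in> I" "q \<in> bounded u (carrier R)" by (auto simp: lead_def)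
    have "(\<lambda>v. p v \<oplus> q v) \<in> I" using I.a_closed[OF p(2) q(2)] by (simp add: mpoly_ring_sel)
    then show "x \<oplus> y \<in> lead u" using bounded_add[OF oneideal p(3) q(3)] p(1) q(1) by (auto simp: lead_def)
  qed
  then show ?thesis by (simp add: submodule_self_module_iff)
qed

text \<open>Multiplication by the variable \<open>j\<close> moves the coefficient at
  \<open>u\<close> to \<open>add_mset j u\<close> and respects the order of monomials.\<close>

lemma lead_mono:
  assumes "j < b"
  shows "lead u \<subseteq> lead (add_mset j u)"
proof
  fix c assume "c \<in> lead u"
  then obtain p where p: "c = p u" "p \<in> I" "p \<in> bounded u (carrier R)" by (auto simp: lead_def)
  let ?x = "monomial \<one> {#j#}"
  let ?q = "?x \<otimes>\<^bsub>P\<^esub> p"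
  have "?x \<in> carrier P" using monomial_grade[of \<one> "{#j#}" b] assms mpoly_grade_subset by auto
  then have q: "?q \<in> I" using I.I_l_closed p(2) by blast
  have qv: "?q v = (if j \<in># v then p (v - {#j#}) else \<zero>)" for v
    using monomial_mult[OF bounded_closed[OF p(3)], of "{#j#}" v] by simp
  have "?q \<in> bounded (add_mset j u) (carrier R)"
    unfolding bounded_def
  proof (intro CollectI conjI allI impI)
    show "?q \<in> mpoly_grade R b (size (add_mset j u))"
    proof (rule mpoly_gradeI)
      show "?q v \<in> carrier R" for v
        using mpoly_grade_coeff_closed[OF bounded_grade[OF p(3)]] by (simp add: qv)
      fix v assume "?q v \<noteq> \<zero>"
      then have "j \<in># v" "p (v - {#j#}) \<noteq> \<zero>" by (auto simp: qv split: if_splits)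
      then obtain w where w: "v = add_mset j w" "p w \<noteq> \<zero>" by (metis insert_DiffM)
      then show "size v = size (add_mset j u) \<and> set_mset v \<subseteq> {..<b}"
        using mpoly_gradeD[OF bounded_grade[OF p(3)], of w] assms by auto
    qed
    show "?q v = \<zero>" if "add_mset j u < v" for v
    proof (cases "j \<in># v")
      case True
      then obtain w where w: "v = add_mset j w" by (metis insert_DiffM)
      then have "u < w" using that by simp
      then show ?thesis using p(3) w by (simp add: qv bounded_def)
    qed (simp add: qv)
    show "?q (add_mset j u) \<in> carrier R" using p(3) by (simp add: qv bounded_def)
  qed
  moreover have "c = ?q (add_mset j u)" using p(1) by (simp add: qv)
  ultimately show "c \<in> lead (add_mset j u)" using q by (auto simp: lead_def)
qed

end

section \<open>Hilbert functions\<close>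

context homogeneous_quotient
begin

text \<open>For an ideal \<open>J i\<close> this says elementwise that \<open>J (Suc i)\<close> is
  not contained in \<open>J i\<close> plus \<open>lead u\<close>.\<close>

definition standard_term :: "(nat \<Rightarrow> 'a set) \<Rightarrow> nat multiset \<Rightarrow> nat \<Rightarrow> bool" where
  "standard_term J u i \<longleftrightarrow> (\<exists>c\<in>J (Suc i). \<forall>d\<in>J i. c \<oplus> d \<notin> lead u)"

lemma ex_leading_monomial:
  assumes "q \<in> mpoly_grade R b n" "q \<noteq> (\<lambda>u. \<zero>)"
  obtains v where "v \<in> multisets_of_size {..<b} n" "q v \<noteq> \<zero>" "q \<in> bounded v (carrier R)"
proof -
  let ?A = "{v. q v \<noteq> \<zero>}"
  have fin: "finite ?A" using assms(1) mpoly_grade_subset by (auto simp: mpoly_ring_def)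
  have ne: "?A \<noteq> {}" using assms(2) by auto
  define v where "v = Max ?A"
  have v: "q v \<noteq> \<zero>" using Max_in[OF fin ne] by (simp add: v_def)
  have "q w = \<zero>" if "w > v" for w
    using Max_ge[OF fin, of w] that by (cases "q w = \<zero>") (auto simp: v_def dest: leD)
  then show ?thesis
    using v mpoly_gradeD[OF assms(1) v] assms(1) mpoly_grade_coeff_closed[OF assms(1)]
    by (intro that[of v]) (auto simp: multisets_of_size_def bounded_def)
qed

text \<open>The pairs \<open>(u, i)\<close> in lexicographic order index a filtration of the piece.
  It jumps exactly at the standard terms, and \<open>module_length_filtration\<close> counts the
  jumps.\<close>

theorem piece_length:
  assumes J: "module.composition_series R (self_module R) J e"
  shows "module_length R (piece n) =
    enat (card {(u, i). size u = n \<and> set_mset u \<subseteq> {..<b} \<and> i < e \<and> standard_term J u i})"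
proof -
  interpret S: module R "self_module R" by (rule self_module_module)
  interpret M: module R "piece n" by (rule piece_module)
  have J0: "J 0 = {\<zero>}" and Je: "J e = carrier R"
    and id: "\<And>i. i \<le> e \<Longrightarrow> ideal (J i) R" and mono: "\<And>i. i < e \<Longrightarrow> J i \<subseteq> J (Suc i)"
    and simple: "\<And>i x y. i < e \<Longrightarrow> x \<in> J (Suc i) \<Longrightarrow> y \<in> J (Suc i) \<Longrightarrow> y \<notin> J i \<Longrightarrow>
      \<exists>r\<in>carrier R. x \<oplus> r \<otimes> y \<in> J i"
    using J by (auto simp: S.composition_series_def S.submodule_chain_def submodule_self_module_iff)
  have J_zero: "\<zero> \<in> J i" if "i \<le> e" for i
    using additive_subgroup.zero_closed[OF ideal.axioms(1)[OF id[OF that]]] .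
  have J_mono: "J i \<subseteq> J k" if "i \<le> k" "k \<le> e" for i k
    using that by (induction rule: dec_induct) (use mono in \<open>auto simp: Suc_le_eq\<close>)
  let ?W = "multisets_of_size {..<b} n \<times> {..<e}"
  let ?G = "\<lambda>w. residue ` bounded (fst w) (J (Suc (snd w)))"
  let ?G' = "\<lambda>w. residue ` bounded (fst w) (J (snd w))"
  have size: "size (fst w) = n" "set_mset (fst w) \<subseteq> {..<b}" "snd w < e" if "w \<in> ?W" for w
    using that by (auto simp: multisets_of_size_def)
  have less: "?G w \<subseteq> ?G' w'" if "w \<in> ?W" "w' \<in> ?W" "w < w'" for w w'
  proof (cases "fst w < fst w'")
    case True
    then show ?thesis
      using bounded_less[of "fst w" "fst w'" "J (snd w')" "J (Suc (snd w))"] size[OF that(1)] size[OF that(2)] J_zero[of "snd w'"]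
      by (intro image_mono) auto
  next
    case False
    then have w: "fst w = fst w'" "snd w < snd w'" using that(3) by (auto simp: less_prod_def')
    then have "J (Suc (snd w)) \<subseteq> J (snd w')" using size[OF that(2)] by (intro J_mono) auto
    then show ?thesis using w by (intro image_mono) (simp add: bounded_mono)
  qed
  have "module_length R (piece n) = enat (card {w \<in> ?W. ?G w \<noteq> ?G' w})"
  proof (rule M.module_length_filtration)
    show "finite ?W" by (simp add: finite_multisets_of_size)
    show "submodule (?G w) R (piece n)" if "w \<in> ?W" for w
      using residue_bounded_submodule[of "J (Suc (snd w))" "fst w"] id size[OF that] by auto
    show "?G' w \<subseteq> ?G w" if "w \<in> ?W" for w
      using mono size[OF that] by (intro image_mono bounded_mono) auto
    show "\<zero>\<^bsub>piece n\<^esub> \<in> ?G' w" if "w \<in> ?W" for w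
      using residue_zero bounded_zero[OF J_zero] size[OF that] by auto
    show "?G w \<subseteq> ?G' w'" if "w \<in> ?W" "w' \<in> ?W" "w < w'" for w w' using less that by blast
  next
    fix x assume x: "x \<in> carrier (piece n)" "x \<noteq> \<zero>\<^bsub>piece n\<^esub>"
    let ?A = "{w \<in> ?W. x \<in> ?G w}"
    \<comment> \<open>Every representative of \<open>x\<close> places \<open>x\<close> in the set
      indexed by its leading monomial and the top index. A nonzero coefficient excludes
      \<open>e = 0\<close>, so \<open>e - 1\<close> does not truncate.\<close>
    have key: "\<exists>v. (v, e - 1) \<in> ?A \<and> q v \<noteq> \<zero> \<and> e \<noteq> 0" if q: "q \<in> mpoly_grade R b n" "x = residue q" for q
    proof -
      have "q \<noteq> (\<lambda>u. \<zero>)" using x(2) q residue_zero by auto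
      then obtain v where v: "v \<in> multisets_of_size {..<b} n" "q v \<noteq> \<zero>" "q \<in> bounded v (carrier R)"
        using ex_leading_monomial[OF q(1)] by blast
      have "e \<noteq> 0" using J0 Je v(2) mpoly_grade_coeff_closed[OF q(1), of v] by (metis singletonD)
      then show ?thesis using v q Je by auto
    qed
    obtain p where "p \<in> mpoly_grade R b n" "x = residue p" using x(1) unfolding piece_carrier by auto
    then have ne: "?A \<noteq> {}" using key by blast
    have fin: "finite ?A" by (rule finite_subset[of _ ?W]) (auto simp: finite_multisets_of_size)
    obtain w where w: "w \<in> ?A" and min: "\<And>w'. w' \<in> ?A \<Longrightarrow> w \<le> w'"
      by (rule that[OF Min_in[OF fin ne] Min_le[OF fin]])
    obtain u i where ui: "w = (u, i)" by (cases w)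
    \<comment> \<open>For positive \<open>i\<close> the set \<open>?G' (u, i)\<close> is
      \<open>?G (u, i - 1)\<close>; for \<open>i = 0\<close> the coefficient at \<open>u\<close>
      vanishes and the representative has a smaller leading monomial. Either way \<open>w\<close>
      would not be minimal.\<close>
    have "x \<notin> ?G' w"
    proof
      assume "x \<in> ?G' w"
      then obtain q where q: "x = residue q" "q \<in> bounded u (J i)" using ui by auto
      have wW: "(u, i) \<in> ?W" using w ui by simp
      show False
      proof (cases i)
        case 0
        then have "q u = \<zero>" using q(2) J0 by (simp add: bounded_def)
        have "q \<in> mpoly_grade R b n" using bounded_grade[OF q(2)] size[OF wW] by simp
        then obtain v where v: "(v, e - 1) \<in> ?A" "q v \<noteq> \<zero>" using key q(1) by blast
        then have "v < u" using q(2) \<open>q u = \<zero>\<close> by (auto simp: bounded_def) (metis linorder_less_linear)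
        then show False using min[OF v(1)] ui by (auto simp: 0)
      next
        case (Suc k)
        then have "(u, k) \<in> ?A" using wW q by auto
        then show False using min[of "(u, k)"] ui Suc by auto
      qed
    qed
    then show "\<exists>w\<in>?W. x \<in> ?G w - ?G' w" using w by blast
  next
    fix w x y assume w: "w \<in> ?W" and "x \<in> ?G w" and y: "y \<in> ?G w - ?G' w"
    then obtain p q where p: "x = residue p" "p \<in> bounded (fst w) (J (Suc (snd w)))"
      and q: "y = residue q" "q \<in> bounded (fst w) (J (Suc (snd w)))" by auto
    have "q \<notin> bounded (fst w) (J (snd w))" using y q by blast
    then have "q (fst w) \<notin> J (snd w)" using q(2) unfolding bounded_def by blast
    then obtain r where r: "r \<in> carrier R" "p (fst w) \<oplus> r \<otimes> q (fst w) \<in> J (snd w)"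
      using simple[OF size(3)[OF w], of "p (fst w)" "q (fst w)"] p(2) q(2) by (auto simp: bounded_def)
    have J': "ideal (J (Suc (snd w))) R" using id size[OF w] by simp
    have "(\<lambda>v. p v \<oplus> r \<otimes> q v) \<in> bounded (fst w) (J (Suc (snd w)))"
      by (intro bounded_add[OF J' p(2)] bounded_scale[OF J' q(2) r(1)])
    then have "(\<lambda>v. p v \<oplus> r \<otimes> q v) \<in> bounded (fst w) (J (snd w))" using r(2) by (simp add: bounded_def)
    moreover have "x \<oplus>\<^bsub>piece n\<^esub> r \<odot>\<^bsub>piece n\<^esub> y = residue (\<lambda>v. p v \<oplus> r \<otimes> q v)"
      using residue_smult[OF r(1) bounded_closed[OF q(2)]] p(1) q(1)
        residue_add[OF bounded_closed[OF p(2)] bounded_closed[OF bounded_scale[OF J' q(2) r(1)]]]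
      by simp
    ultimately show "\<exists>r\<in>carrier R. x \<oplus>\<^bsub>piece n\<^esub> r \<odot>\<^bsub>piece n\<^esub> y \<in> ?G' w" using r(1) by auto
  qed
  moreover have "{w \<in> ?W. ?G w \<noteq> ?G' w}
      = {(u, i). size u = n \<and> set_mset u \<subseteq> {..<b} \<and> i < e \<and> standard_term J u i}"
  proof (rule Set.set_eqI)
    fix w :: "nat multiset \<times> nat"
    obtain u i where w: "w = (u, i)" by (cases w)
    have "?G w \<noteq> ?G' w \<longleftrightarrow> standard_term J u i" if "set_mset u \<subseteq> {..<b}" "i < e"
      unfolding standard_term_def w fst_conv snd_conv
      using id mono that by (intro residue_bounded_neq_iff) auto
    then show "w \<in> {w \<in> ?W. ?G w \<noteq> ?G' w} \<longleftrightarrow>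
        w \<in> {(u, i). size u = n \<and> set_mset u \<subseteq> {..<b} \<and> i < e \<and> standard_term J u i}"
      using w by (auto simp: multisets_of_size_def)
  qed
  ultimately show ?thesis by simp
qed

lemma lead_empty:
  assumes "I \<subseteq> mpoly_positive_part R b"
  shows "lead {#} = {\<zero>}"
proof -
  have "p {#} = \<zero>" if "p \<in> I" for p
    using assms that by (fastforce simp: mpoly_positive_part_def)
  then have "lead {#} \<subseteq> {\<zero>}" by (auto simp: lead_def)
  then show ?thesis
    using additive_subgroup.zero_closed[OF ideal.axioms(1)[OF lead_ideal]] by blast
qed

lemma ex_no_zero_sum:
  assumes "ideal N R" "ideal N' R" "N' \<subset> N"
  shows "\<exists>c\<in>N. \<forall>d\<in>N'. c \<oplus> d \<notin> {\<zero>}"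
proof -
  interpret N: ideal N R by fact
  interpret N': ideal N' R by fact
  obtain c where c: "c \<in> N" "c \<notin> N'" using assms(3) by blast
  have "c \<oplus> d \<noteq> \<zero>" if "d \<in> N'" for d
    using minus_equality[of c d] c that N.a_Hcarr[OF c(1)] N'.a_Hcarr N'.a_inv_closed[OF that]
    by (metis minus_minus)
  then show ?thesis using c by blast
qed

text \<open>Elements of \<open>I\<close> have no constant term, so \<open>lead {#}\<close> is zero
  and each step of a composition series counts once. For infinite length, chains of ideals are
  carried over to chains in degree 0.\<close>

lemma piece_zero_length:
  assumes pos: "I \<subseteq> mpoly_positive_part R b"
  shows "module_length R (piece 0) = module_length R (self_module R)"
proof (cases "module_length R (self_module R)")
  case (enat e)
  interpret S: module R "self_module R" by (rule self_module_module)
  obtain J where J: "S.composition_series J e" using S.ex_composition_series[OF enat] by blast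
  have "standard_term J {#} i" if "i < e" for i
    unfolding standard_term_def lead_empty[OF pos]
    using J that by (intro ex_no_zero_sum)
      (auto simp: S.composition_series_def S.submodule_chain_def submodule_self_module_iff)
  then have "{(u, i). size u = 0 \<and> set_mset u \<subseteq> {..<b} \<and> i < e \<and> standard_term J u i} = Pair {#} ` {..<e}"
    by auto
  then show ?thesis using piece_length[OF J, of 0] enat by (simp add: card_image inj_on_def)
next
  case infinity
  interpret S: module R "self_module R" by (rule self_module_module)
  interpret M: module R "piece 0" by (rule piece_module)
  have "module_length R (self_module R) \<le> module_length R (piece 0)"
    unfolding S.module_length_eq
  proof (rule Sup_least)
    fix l assume "l \<in> {enat k | k. \<exists>N. S.submodule_chain N k}"
    then obtain k N where l: "l = enat k" and N: "S.submodule_chain N k" by auto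
    have id: "ideal (N i) R" if "i \<le> k" for i
      using N that by (simp add: S.submodule_chain_def submodule_self_module_iff)
    have "M.submodule_chain (\<lambda>i. residue ` bounded {#} (N i)) k"
      unfolding M.submodule_chain_def
    proof (intro conjI allI impI)
      fix i assume "i \<le> k"
      then show "submodule (residue ` bounded {#} (N i)) R (piece 0)"
        using residue_bounded_submodule[of "N i" "{#}"] id by simp
    next
      fix i assume i: "i < k"
      have NN: "N i \<subset> N (Suc i)" using N i by (simp add: S.submodule_chain_def)
      have "residue ` bounded {#} (N (Suc i)) \<noteq> residue ` bounded {#} (N i)"
        using residue_bounded_neq_iff[of "N (Suc i)" "N i" "{#}"] ex_no_zero_sum[of "N (Suc i)" "N i"]
          lead_empty[OF pos] id i NN by auto
      then show "residue ` bounded {#} (N i) \<subset> residue ` bounded {#} (N (Suc i))"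
        using bounded_mono[of "N i" "N (Suc i)" "{#}"] NN by blast
    qed
    then show "l \<le> module_length R (piece 0)" unfolding l by (rule M.submodule_chain_le_length)
  qed
  then show ?thesis using infinity by simp
qed

end

section \<open>The two implications over a local ring\<close>

context local_ring
begin

lemmas maximal_closed =
  additive_subgroup.zero_closed[OF is_additive_subgroup]
  additive_subgroup.a_closed[OF is_additive_subgroup]
  additive_subgroup.a_inv_closed[OF is_additive_subgroup]

lemma one_plus_notin: "d \<in> \<mm> \<Longrightarrow> \<one> \<oplus> d \<notin> \<mm>"
proof
  assume d: "d \<in> \<mm>" and "\<one> \<oplus> d \<in> \<mm>"
  then have "\<one> \<oplus> d \<oplus> \<ominus> d \<in> \<mm>" using d by (blast intro: maximal_closed)
  moreover have "\<one> \<oplus> d \<oplus> \<ominus> d = \<one>" using a_Hcarr[OF d] by (simp add: a_assoc r_neg)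
  ultimately show False using one_imp_carrier I_notcarr by simp
qed

text \<open>Finite length of the ring comes from \<open>H 0\<close> being a number. Standard terms
  meet the closure conditions of \<open>card_labelled_le_binomial_shift\<close> with
  \<open>t\<close> equal to \<open>e - 1\<close>: leading ideals grow along multiplication by
  variables, and 1 is not in \<open>J (e - 1)\<close> plus a proper leading ideal, as both lie in
  the maximal ideal.\<close>

lemma hilbert_function_growth:
  assumes hom: "homogeneous_ideal R b I" and pos: "I \<subseteq> mpoly_positive_part R b"
    and H: "\<And>n. enat (H n) = hilbert_function R (graded_quotient R b I) n"
  shows "enat (H 0) = module_length R (self_module R)"
    and "n \<ge> 1 \<Longrightarrow> H (n + 1) \<le> binomial_shift (H n) n"
proof -
  interpret Q: homogeneous_quotient R b I by unfold_locales (rule hom)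
  interpret S: module R "self_module R" by (rule self_module_module)
  have H': "module_length R (Q.piece n) = enat (H n)" for n
    using H[of n] by (simp add: hilbert_function_def)
  show len: "enat (H 0) = module_length R (self_module R)"
    using H'[of 0] Q.piece_zero_length[OF pos] by simp
  define e where "e = H 0"
  have len': "module_length R (self_module R) = enat e" using len by (simp add: e_def)
  obtain J where J: "S.composition_series J e" using S.ex_composition_series[OF len'] by blast
  have Je: "J e = carrier R" and id: "\<And>i. i \<le> e \<Longrightarrow> ideal (J i) R" and ss: "\<And>i. i < e \<Longrightarrow> J i \<subset> J (Suc i)"
    using J by (auto simp: S.composition_series_def S.submodule_chain_def submodule_self_module_iff)
  let ?St = "\<lambda>u i. set_mset u \<subseteq> {..<b} \<and> i < e \<and> Q.standard_term J u i"
  have card: "card {(u, i). size u = n \<and> ?St u i} = H n" for n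
    using Q.piece_length[OF J, of n] H'[of n] by simp
  have down: "?St u i" "?St u (e - 1)" if "?St (add_mset j u) i" for j u i
  proof -
    have jb: "j < b" and i: "i < e" and u: "set_mset u \<subseteq> {..<b}" using that by auto
    have "Q.standard_term J (add_mset j u) i" using that by simp
    then obtain c where c: "c \<in> J (Suc i)" "\<And>d. d \<in> J i \<Longrightarrow> c \<oplus> d \<notin> Q.lead (add_mset j u)"
      unfolding Q.standard_term_def by blast
    have notin: "c \<oplus> d \<notin> Q.lead u" if "d \<in> J i" for d
      using c(2)[OF that] Q.lead_mono[OF jb] by blast
    then show "?St u i" using c(1) u i by (auto simp: Q.standard_term_def)
    \<comment> \<open>Since \<open>J i\<close> contains 0, the element \<open>c\<close> itself is
      missing from \<open>lead u\<close>, which is therefore proper.\<close>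
    have "c \<oplus> \<zero> \<in> carrier R"
      using c(1) ideal.Icarr[OF id[of "Suc i"]] i by simp
    then have "Q.lead u \<noteq> carrier R"
      using notin[of \<zero>] additive_subgroup.zero_closed[OF ideal.axioms(1)[OF id[of i]]] i by auto
    then have L: "Q.lead u \<subseteq> \<mm>" by (intro proper_ideal_le[OF len' Q.lead_ideal])
    have e: "Suc (e - 1) = e" using i by simp
    have "J (e - 1) \<subset> carrier R" using ss[of "e - 1"] i e Je by simp
    then have "J (e - 1) \<subseteq> \<mm>" by (intro proper_ideal_le[OF len' id]) auto
    then have "\<one> \<oplus> d \<notin> Q.lead u" if "d \<in> J (e - 1)" for d using one_plus_notin that L by blast
    then have "Q.standard_term J u (e - 1)"
      unfolding Q.standard_term_def e Je by (intro bexI[of _ \<one>]) auto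
    then show "?St u (e - 1)" using u i by simp
  qed
  have fin: "finite {(u, i). size u = n \<and> ?St u i}" for n
  proof (rule finite_subset)
    show "{(u, i). size u = n \<and> ?St u i} \<subseteq> multisets_of_size {..<b} n \<times> {..<e}"
      by (auto simp: multisets_of_size_def)
  qed (simp add: finite_multisets_of_size)
  show "H (n + 1) \<le> binomial_shift (H n) n" if "n \<ge> 1"
  proof -
    have "card {(u, i). size u = Suc n \<and> ?St u i} \<le> binomial_shift (card {(u, i). size u = n \<and> ?St u i}) n"
    proof (rule card_labelled_le_binomial_shift[OF fin _ _ that])
      show "?St u i" "?St u (e - 1)" if "?St (add_mset j u) i" for j u i
        by (rule down[OF that])+
    qed
    then show ?thesis by (simp add: card)
  qed
qed

text \<open>In the coefficient of a product at \<open>u\<close> in \<open>S\<close>, each factor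
  \<open>q (u - v)\<close> is either the vanishing constant term or, by the closure of
  \<open>S\<close>, lies in the maximal ideal. The quotient keeps the ring in degree 0 and only
  residue field coefficients on \<open>S\<close> above.\<close>

lemma monomial_quotient:
  fixes S b
  assumes S: "\<forall>u\<in>S. \<forall>v. v \<subseteq># u \<longrightarrow> v \<noteq> {#} \<longrightarrow> v \<in> S"
  defines "I \<equiv> {p \<in> carrier (mpoly_ring R b). p {#} = \<zero> \<and> (\<forall>u\<in>S. p u \<in> \<mm>)}"
  shows "homogeneous_ideal R b I" "I \<subseteq> mpoly_positive_part R b"
proof -
  let ?P = "mpoly_ring R b"
  interpret P: cring ?P by (rule mpoly_ring_cring)
  have z: "\<zero> \<in> \<mm>" by (rule maximal_closed)
  have mult: "p \<otimes>\<^bsub>?P\<^esub> q \<in> I" if p: "p \<in> carrier ?P" and q: "q \<in> I" for p q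
  proof -
    have qP: "q \<in> carrier ?P" using q by (simp add: I_def)
    have pc: "p v \<in> carrier R" "q v \<in> carrier R" for v using p qP mpoly_coeff_closed by blast+
    have "(\<Oplus>v\<in>{v. v \<subseteq># u}. p v \<otimes> q (u - v)) \<in> \<mm>" if "u \<in> S" for u
    proof -
      have term_in: "p v \<otimes> q (u - v) \<in> \<mm>" if v: "v \<subseteq># u" for v
      proof (cases "u - v = {#}")
        case True
        then show ?thesis using q z pc[of v] by (simp add: I_def)
      next
        case False
        then have "u - v \<in> S" using S \<open>u \<in> S\<close> by simp
        then show ?thesis using q pc by (intro I_l_closed) (auto simp: I_def)
      qed
      have "finsum R (\<lambda>v. p v \<otimes> q (u - v)) A \<in> \<mm>" if "finite A" "A \<subseteq> {v. v \<subseteq># u}" for A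
        using that
      proof (induction A)
        case (insert v A)
        then show ?case
          using term_in pc by (subst finsum_insert) (auto intro: maximal_closed)
      qed (simp add: z)
      then show ?thesis by (simp add: finite_submultisets)
    qed
    moreover have "(p \<otimes>\<^bsub>?P\<^esub> q) {#} = \<zero>"
      using q pc by (simp add: mpoly_ring_sel I_def)
    ultimately show ?thesis using P.m_closed[OF p qP] by (simp add: I_def mpoly_ring_sel)
  qed
  have "ideal I ?P"
  proof (rule idealI)
    show "ring ?P" by (rule P.ring_axioms)
    show "subgroup I (add_monoid ?P)"
    proof (rule P.add.subgroupI)
      show "I \<subseteq> carrier ?P" by (auto simp: I_def)
      have "\<zero>\<^bsub>?P\<^esub> \<in> I" using P.zero_closed z by (simp add: I_def mpoly_ring_sel)
      then show "I \<noteq> {}" by blast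
      show "\<ominus>\<^bsub>?P\<^esub> p \<in> I" if "p \<in> I" for p
      proof -
        have "p \<in> carrier ?P" using that by (simp add: I_def)
        then have "\<ominus>\<^bsub>?P\<^esub> p = (\<ominus>\<^bsub>?P\<^esub> \<one>\<^bsub>?P\<^esub>) \<otimes>\<^bsub>?P\<^esub> p" by (simp add: P.l_minus)
        then show ?thesis using mult[OF _ that] by simp
      qed
      show "p \<oplus>\<^bsub>?P\<^esub> q \<in> I" if "p \<in> I" "q \<in> I" for p q
        using that P.a_closed[of p q] by (auto simp: I_def mpoly_ring_sel intro: maximal_closed)
    qed
    show "x \<otimes>\<^bsub>?P\<^esub> a \<in> I" "a \<otimes>\<^bsub>?P\<^esub> x \<in> I" if "a \<in> I" "x \<in> carrier ?P" for a x
      using mult[OF that(2,1)] P.m_comm[of a x] that by (auto simp: I_def)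
  qed
  moreover have "homogeneous_component R n p \<in> I" if "p \<in> I" for p n
  proof -
    have p: "p \<in> carrier ?P" "p {#} = \<zero>" "\<And>u. u \<in> S \<Longrightarrow> p u \<in> \<mm>" using that by (auto simp: I_def)
    have "homogeneous_component R n p \<in> mpoly_grade R b n"
      using p(1) mpoly_coeff_closed[OF p(1)]
      by (intro mpoly_gradeI) (auto simp: homogeneous_component_def mpoly_ring_def split: if_splits)
    then have "homogeneous_component R n p \<in> carrier ?P" using mpoly_grade_subset by blast
    then show ?thesis using p z by (auto simp: I_def homogeneous_component_def)
  qed
  ultimately show "homogeneous_ideal R b I" by (simp add: homogeneous_ideal_def)
  show "I \<subseteq> mpoly_positive_part R b"
    by (auto simp: I_def mpoly_positive_part_def Suc_le_eq nonempty_has_size[symmetric])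
qed

text \<open>For nonempty \<open>u\<close> in the given variables, \<open>lead u\<close> is the
  maximal ideal if \<open>u\<close> is in \<open>S\<close> and the whole ring otherwise. So in
  positive degrees each member of \<open>S\<close> gives one standard term, at the top index
  \<open>e - 1\<close>.\<close>

lemma ex_standard_algebra:
  assumes len: "enat (H 0) = module_length R (self_module R)"
    and H: "\<And>n. n \<ge> 1 \<Longrightarrow> H (n + 1) \<le> binomial_shift (H n) n"
  shows "\<exists>S. standard_algebra R S \<and> (\<forall>n. enat (H n) = hilbert_function R S n)"
proof -
  interpret Self: module R "self_module R" by (rule self_module_module)
  obtain S where S: "\<And>u. u \<in> S \<Longrightarrow> set_mset u \<subseteq> {..<H 1}"
    "\<And>u v. u \<in> S \<Longrightarrow> v \<subseteq># u \<Longrightarrow> v \<noteq> {#} \<Longrightarrow> v \<in> S"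
    "\<And>n. n \<ge> 1 \<Longrightarrow> card {u \<in> S. size u = n} = H n"
    using ex_order_ideal[of H] H by blast
  \<comment> \<open>At least one variable is required even if \<open>H 1 = 0\<close>; that variable
    then lies in \<open>I\<close>.\<close>
  define b where "b = max 1 (H 1)"
  define I where "I = {p \<in> carrier (mpoly_ring R b). p {#} = \<zero> \<and> (\<forall>u\<in>S. p u \<in> \<mm>)}"
  have hom: "homogeneous_ideal R b I" and pos: "I \<subseteq> mpoly_positive_part R b"
    unfolding I_def using monomial_quotient[of S b] S(2) by blast+
  interpret Q: homogeneous_quotient R b I by unfold_locales (rule hom)
  define e where "e = H 0"
  have len': "module_length R (self_module R) = enat e" using len by (simp add: e_def)
  obtain J where J: "Self.composition_series J e" using Self.ex_composition_series[OF len'] by blast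
  have J0: "J 0 = {\<zero>}" and Je: "J e = carrier R" and id: "\<And>i. i \<le> e \<Longrightarrow> ideal (J i) R"
    and ss: "\<And>i. i < e \<Longrightarrow> J i \<subset> J (Suc i)"
    using J by (auto simp: Self.composition_series_def Self.submodule_chain_def submodule_self_module_iff)
  have J_le: "J i \<subseteq> \<mm>" if "i < e" for i
  proof -
    have "J i \<subset> carrier R" using ss[OF that] ideal.Icarr[OF id[of "Suc i"]] that by auto
    then show ?thesis using that by (intro proper_ideal_le[OF len' id]) auto
  qed
  have "\<one> \<notin> \<mm>" using one_imp_carrier I_notcarr by auto
  then have "e \<noteq> 0" using J0 Je maximal_closed(1) by (metis one_closed singletonD)
  have mono_in: "c \<in> Q.lead u" if u: "set_mset u \<subseteq> {..<b}" "u \<noteq> {#}" and c: "c \<in> carrier R" "u \<in> S \<Longrightarrow> c \<in> \<mm>" for c u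
  proof -
    have m: "monomial c u \<in> Q.bounded u (carrier R)" by (rule Q.bounded_monomial[OF u(1) c(1) c(1)])
    have "monomial c u v \<in> \<mm>" if "v \<in> S" for v
      using c(2) that maximal_closed(1) by (cases "v = u") (simp_all add: monomial_def)
    moreover have "monomial c u {#} = \<zero>" using u(2) by (simp add: monomial_def)
    ultimately have "monomial c u \<in> I" unfolding I_def by (intro CollectI conjI ballI Q.bounded_closed[OF m])
    then show ?thesis
      unfolding Q.lead_def by (intro image_eqI[of _ _ "monomial c u"] IntI m monomial_same[symmetric])
  qed
  have lead: "Q.lead u \<subseteq> \<mm>" if "u \<in> S" for u
  proof
    fix c assume "c \<in> Q.lead u"
    then obtain p where "c = p u" "p \<in> I" unfolding Q.lead_def by (elim imageE IntE)
    moreover from \<open>p \<in> I\<close> have "\<forall>u\<in>S. p u \<in> \<mm>" unfolding I_def by (elim CollectE conjE)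
    ultimately show "c \<in> \<mm>" using that by metis
  qed
  have St: "Q.standard_term J u i \<longleftrightarrow> u \<in> S \<and> i = e - 1"
    if u: "set_mset u \<subseteq> {..<b}" "u \<noteq> {#}" and i: "i < e" for u i
  proof
    assume "Q.standard_term J u i"
    then obtain c where c: "c \<in> J (Suc i)" "\<And>d. d \<in> J i \<Longrightarrow> c \<oplus> d \<notin> Q.lead u"
      unfolding Q.standard_term_def by blast
    have cc: "c \<in> carrier R" using c(1) ideal.Icarr[OF id[of "Suc i"]] i by simp
    have "\<zero> \<in> J i" using additive_subgroup.zero_closed[OF ideal.axioms(1)[OF id[of i]]] i by simp
    then have "c \<notin> Q.lead u" using c(2)[of \<zero>] cc by simp
    then have uS: "u \<in> S" "c \<notin> \<mm>" using mono_in[OF u cc] by auto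
    then have "\<not> Suc i < e" using J_le c(1) by blast
    then show "u \<in> S \<and> i = e - 1" using uS i by auto
  next
    assume u: "u \<in> S \<and> i = e - 1"
    then have e: "Suc i = e" using \<open>e \<noteq> 0\<close> by simp
    have "\<one> \<oplus> d \<notin> Q.lead u" if "d \<in> J i" for d
      using one_plus_notin[of d] that J_le[OF i] lead[of u] u by blast
    then show "Q.standard_term J u i" unfolding Q.standard_term_def e Je by (intro bexI[of _ \<one>]) auto
  qed
  have "module_length R (Q.piece n) = enat (H n)" for n
  proof (cases "n = 0")
    case True
    then show ?thesis using Q.piece_zero_length[OF pos] len by simp
  next
    case False
    have "{(u, i). size u = n \<and> set_mset u \<subseteq> {..<b} \<and> i < e \<and> Q.standard_term J u i}
        = (\<lambda>u. (u, e - 1)) ` {u \<in> S. size u = n}"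
    proof (intro subset_antisym subsetI)
      fix w assume "w \<in> {(u, i). size u = n \<and> set_mset u \<subseteq> {..<b} \<and> i < e \<and> Q.standard_term J u i}"
      then obtain u i where u: "w = (u, i)" "size u = n" "set_mset u \<subseteq> {..<b}" "i < e" "Q.standard_term J u i"
        by blast
      then have "u \<noteq> {#}" using False by auto
      then have "u \<in> S" "i = e - 1" using St[OF u(3) _ u(4)] u(5) by blast+
      then show "w \<in> (\<lambda>u. (u, e - 1)) ` {u \<in> S. size u = n}" using u by blast
    next
      fix w assume "w \<in> (\<lambda>u. (u, e - 1)) ` {u \<in> S. size u = n}"
      then obtain u where u: "w = (u, e - 1)" "u \<in> S" "size u = n" by auto
      then have "set_mset u \<subseteq> {..<b}" using S(1)[OF u(2)] by (auto simp: b_def)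
      then show "w \<in> {(u, i). size u = n \<and> set_mset u \<subseteq> {..<b} \<and> i < e \<and> Q.standard_term J u i}"
        using u St[of u "e - 1"] False \<open>e \<noteq> 0\<close> by (cases "u = {#}") auto
    qed
    then have "module_length R (Q.piece n) = enat (card {u \<in> S. size u = n})"
      using Q.piece_length[OF J, of n] by (simp add: card_image inj_on_def)
    then show ?thesis using S(3)[of n] False by simp
  qed
  then have "\<forall>n. enat (H n) = hilbert_function R (graded_quotient R b I) n"
    by (simp add: hilbert_function_def)
  moreover have "standard_algebra R (graded_quotient R b I)"
    unfolding standard_algebra_def using hom pos by (intro exI[of _ b] exI[of _ I] conjI) (auto simp: b_def)
  ultimately show ?thesis by blast
qed

end

theorem corollary2p10:
  fixes R\<^sub>0 :: "('a, 'm) ring_scheme" and \<mm> :: "'a set" and H :: "nat \<Rightarrow> nat"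
  assumes "artinian_ring R\<^sub>0"
    and "local_ring \<mm> R\<^sub>0"
    and "equicharacteristic \<mm> R\<^sub>0"
  shows "(\<exists>S. standard_algebra R\<^sub>0 S \<and> (\<forall>n. enat (H n) = hilbert_function R\<^sub>0 S n)) \<longleftrightarrow>
         (enat (H 0) = module_length R\<^sub>0 (self_module R\<^sub>0) \<and>
          (\<forall>n\<ge>1. H (n + 1) \<le> binomial_shift (H n) n))"
proof
  interpret local_ring \<mm> R\<^sub>0 by (rule assms(2))
  {
    assume "\<exists>S. standard_algebra R\<^sub>0 S \<and> (\<forall>n. enat (H n) = hilbert_function R\<^sub>0 S n)"
    then obtain b I where "homogeneous_ideal R\<^sub>0 b I" "I \<subseteq> mpoly_positive_part R\<^sub>0 b"
      "\<And>n. enat (H n) = hilbert_function R\<^sub>0 (graded_quotient R\<^sub>0 b I) n"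
      unfolding standard_algebra_def by blast
    from hilbert_function_growth[OF this]
    show "enat (H 0) = module_length R\<^sub>0 (self_module R\<^sub>0) \<and>
          (\<forall>n\<ge>1. H (n + 1) \<le> binomial_shift (H n) n)" by blast
  next
    assume "enat (H 0) = module_length R\<^sub>0 (self_module R\<^sub>0) \<and>
          (\<forall>n\<ge>1. H (n + 1) \<le> binomial_shift (H n) n)"
    then show "\<exists>S. standard_algebra R\<^sub>0 S \<and> (\<forall>n. enat (H n) = hilbert_function R\<^sub>0 S n)"
      by (intro ex_standard_algebra) auto
  }
qed

end
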